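(* Let $b(z)=\sum_{j=-m}^{k}b_jz^j$ be an arbitrary Laurent polynomial with $m,k\in\mathbb{N}$ ($m,k\ge1$), $b_j\in\mathbb{C}$, $b_{-m}b_k\ne0$. Then there is a constant $C(b)>0$, depending only on $b$, such that $$\|(T_b-w)^{-1}\|\le \frac{C(b)}{\operatorname{dist}(w,\sigma(T_b))}\left(1+\frac1{\operatorname{dist}(w,\sigma(T_b))}\right)\qquad\text{for all } w\in\rho(T_b).$$
   Context: Notation: $\mathbb{T}=\{z\in\mathbb{C}:|z|=1\}$. The Toeplitz operator $T_b$ acts on the Hardy space $H^2(\mathbb{T})$ by $T_bf=P_+(bf)$, where $P_+$ is the orthogonal projection of $L^2(\mathbb{T})$ onto $H^2(\mathbb{T})$; equivalently, $T_b$ is the operator on $\ell^2(\mathbb{N})$ with matrix $(b_{i-j})_{i,j\ge1}$, where $b_n$ are the Fourier coefficients of $b$. Here $\sigma(T_b)$ is the spectrum, $\rho(T_b)=\mathbb{C}\setminus\sigma(T_b)$ the resolvent set, and $\|\cdot\|$ the operator norm. *)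

theory Defs
  imports "HOL-Analysis.Analysis"
begin

section \<open>The complex sequence space l2 over the natural numbers\<close>

text \<open>
  The sequences start at index 0 instead of 1. This does not affect Toeplitz matrices, whose
  entries depend only on the difference of the two indices.
\<close>

typedef ell2 = "{x :: nat \<Rightarrow> complex. summable (\<lambda>n. (cmod (x n))\<^sup>2)}"
  morphisms coord Abs_ell2
  by (rule exI[of _ "\<lambda>_. 0"]) simp

setup_lifting type_definition_ell2

lemma summable_coord: "summable (\<lambda>n. (cmod (coord x n))\<^sup>2)"
  using coord[of x] by simp

lemma ell2_eqI: "(\<And>n. coord x n = coord y n) \<Longrightarrow> x = y"
  by (metis coord_inject ext)

lemma square_summable_add:
  fixes x y :: "nat \<Rightarrow> complex"
  assumes "summable (\<lambda>n. (cmod (x n))\<^sup>2)" "summable (\<lambda>n. (cmod (y n))\<^sup>2)"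
  shows "summable (\<lambda>n. (cmod (x n + y n))\<^sup>2)"
proof (rule summable_comparison_test')
  show "summable (\<lambda>n. 2 * (cmod (x n))\<^sup>2 + 2 * (cmod (y n))\<^sup>2)"
    using assms by (intro summable_add summable_mult)
  fix n :: nat
  have "(cmod (x n + y n))\<^sup>2 \<le> (cmod (x n) + cmod (y n))\<^sup>2"
    by (intro power_mono norm_triangle_ineq) auto
  also have "\<dots> \<le> 2 * (cmod (x n))\<^sup>2 + 2 * (cmod (y n))\<^sup>2"
    using sum_squares_bound[of "cmod (x n)" "cmod (y n)"] by (simp add: power2_sum)
  finally show "norm ((cmod (x n + y n))\<^sup>2) \<le> 2 * (cmod (x n))\<^sup>2 + 2 * (cmod (y n))\<^sup>2"
    by simp
qed

lemma square_summable_mult: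
  fixes x :: "nat \<Rightarrow> complex"
  assumes "summable (\<lambda>n. (cmod (x n))\<^sup>2)"
  shows "summable (\<lambda>n. (cmod (c * x n))\<^sup>2)"
  using summable_mult[OF assms, of "(cmod c)\<^sup>2"] by (simp add: norm_mult power_mult_distrib)

lift_definition scaleC :: "complex \<Rightarrow> ell2 \<Rightarrow> ell2"  (infixr "*\<^sub>C" 75)
  is "\<lambda>c x n. c * x n"
  by (rule square_summable_mult)

instantiation ell2 :: real_normed_vector
begin

lift_definition zero_ell2 :: ell2 is "\<lambda>_. 0" by simp

lift_definition plus_ell2 :: "ell2 \<Rightarrow> ell2 \<Rightarrow> ell2" is "\<lambda>x y n. x n + y n"
  by (rule square_summable_add)

lift_definition uminus_ell2 :: "ell2 \<Rightarrow> ell2" is "\<lambda>x n. - x n" by simp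

lift_definition minus_ell2 :: "ell2 \<Rightarrow> ell2 \<Rightarrow> ell2" is "\<lambda>x y n. x n - y n"
  using square_summable_add[of _ "\<lambda>n. - _ n"] by simp

definition scaleR_ell2 :: "real \<Rightarrow> ell2 \<Rightarrow> ell2"
  where "scaleR_ell2 r x = complex_of_real r *\<^sub>C x"

definition norm_ell2 :: "ell2 \<Rightarrow> real"
  where "norm_ell2 x = sqrt (\<Sum>n. (cmod (coord x n))\<^sup>2)"

definition sgn_ell2 :: "ell2 \<Rightarrow> ell2"
  where "sgn_ell2 x = inverse (norm x) *\<^sub>R x"

definition dist_ell2 :: "ell2 \<Rightarrow> ell2 \<Rightarrow> real"
  where "dist_ell2 x y = norm (x - y)"

definition uniformity_ell2 :: "(ell2 \<times> ell2) filter"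
  where "uniformity_ell2 = (INF e\<in>{0<..}. principal {(x, y). dist x y < e})"

definition open_ell2 :: "ell2 set \<Rightarrow> bool"
  where "open_ell2 U \<longleftrightarrow> (\<forall>x\<in>U. eventually (\<lambda>(x', y). x' = x \<longrightarrow> y \<in> U) uniformity)"

instance
proof
  fix x y z :: ell2 and a b :: real
  show "x + y + z = x + (y + z)" by transfer (simp add: add.assoc)
  show "x + y = y + x" by transfer (simp add: add.commute)
  show "0 + x = x" by transfer simp
  show "- x + x = 0" by transfer simp
  show "x - y = x + - y" by transfer simp
  show "a *\<^sub>R (x + y) = a *\<^sub>R x + a *\<^sub>R y"
    unfolding scaleR_ell2_def by transfer (simp add: algebra_simps)
  show "(a + b) *\<^sub>R x = a *\<^sub>R x + b *\<^sub>R x"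
    unfolding scaleR_ell2_def by transfer (simp add: algebra_simps)
  show "a *\<^sub>R b *\<^sub>R x = (a * b) *\<^sub>R x"
    unfolding scaleR_ell2_def by transfer (simp add: algebra_simps)
  show "1 *\<^sub>R x = x"
    unfolding scaleR_ell2_def by transfer simp
  show "dist x y = norm (x - y)" by (rule dist_ell2_def)
  show "sgn x = inverse (norm x) *\<^sub>R x" by (rule sgn_ell2_def)
  show "uniformity = (INF e\<in>{0<..}. principal {(x, y :: ell2). dist x y < e})"
    by (rule uniformity_ell2_def)
  show "open U \<longleftrightarrow> (\<forall>x\<in>U. eventually (\<lambda>(x', y). x' = x \<longrightarrow> y \<in> U) uniformity)"
    for U :: "ell2 set" by (rule open_ell2_def)
  show "norm x = 0 \<longleftrightarrow> x = 0"
  proof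
    assume "norm x = 0"
    then have "(cmod (coord x n))\<^sup>2 = 0" for n
      using suminf_eq_zero_iff[OF summable_coord[of x]] by (simp add: norm_ell2_def)
    then show "x = 0" by (intro ell2_eqI) (simp add: zero_ell2.rep_eq)
  qed (simp add: norm_ell2_def zero_ell2.rep_eq)
  show "norm (a *\<^sub>R x) = \<bar>a\<bar> * norm x"
    using suminf_mult[OF summable_coord[of x], of "a\<^sup>2"]
    by (simp add: norm_ell2_def scaleR_ell2_def scaleC.rep_eq norm_mult power_mult_distrib
        real_sqrt_mult)
  have partial: "L2_set (\<lambda>n. cmod (coord u n)) {..<N} \<le> norm u" for u :: ell2 and N
    unfolding L2_set_def norm_ell2_def
    by (intro real_sqrt_le_mono sum_le_suminf summable_coord) auto
  have "(\<Sum>n. (cmod (coord (x + y) n))\<^sup>2) \<le> (norm x + norm y)\<^sup>2"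
  proof (rule suminf_le_const[OF summable_coord])
    fix N :: nat
    have "L2_set (\<lambda>n. cmod (coord (x + y) n)) {..<N}
        \<le> L2_set (\<lambda>n. cmod (coord x n) + cmod (coord y n)) {..<N}"
      by (intro L2_set_mono) (auto simp: plus_ell2.rep_eq norm_triangle_ineq)
    also have "\<dots> \<le> norm x + norm y"
      using partial[of x N] partial[of y N]
      by (intro order_trans[OF L2_set_triangle_ineq] add_mono)
    finally have "(L2_set (\<lambda>n. cmod (coord (x + y) n)) {..<N})\<^sup>2 \<le> (norm x + norm y)\<^sup>2"
      by (intro power_mono L2_set_nonneg)
    then show "(\<Sum>n<N. (cmod (coord (x + y) n))\<^sup>2) \<le> (norm x + norm y)\<^sup>2"
      by (simp add: L2_set_def sum_nonneg)
  qed
  moreover have "norm u \<ge> 0" for u :: ell2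
    by (simp add: norm_ell2_def suminf_nonneg summable_coord)
  ultimately show "norm (x + y) \<le> norm x + norm y"
    unfolding norm_ell2_def[of "x + y"] by (intro real_le_lsqrt) simp_all
qed

end


section \<open>Bounded operators, resolvent set and spectrum\<close>

definition bounded_clinear :: "(ell2 \<Rightarrow> ell2) \<Rightarrow> bool"
  where "bounded_clinear A \<longleftrightarrow> bounded_linear A \<and> (\<forall>c x. A (c *\<^sub>C x) = c *\<^sub>C A x)"

definition resolvent_set :: "(ell2 \<Rightarrow> ell2) \<Rightarrow> complex set"
  where "resolvent_set A = {w. \<exists>B. bounded_clinear B \<and>
    (\<forall>x. B (A x - w *\<^sub>C x) = x) \<and> (\<forall>x. A (B x) - w *\<^sub>C B x = x)}"

definition spectrum :: "(ell2 \<Rightarrow> ell2) \<Rightarrow> complex set"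
  where "spectrum A = - resolvent_set A"

definition resolvent :: "(ell2 \<Rightarrow> ell2) \<Rightarrow> complex \<Rightarrow> ell2 \<Rightarrow> ell2"
  where "resolvent A w = inv (\<lambda>x. A x - w *\<^sub>C x)"


section \<open>Toeplitz operators\<close>

definition fourier_coeff :: "(complex \<Rightarrow> complex) \<Rightarrow> int \<Rightarrow> complex"
  where "fourier_coeff f n =
    complex_of_real (1 / (2 * pi)) * integral {0..2 * pi} (\<lambda>t. f (cis t) * cis (- of_int n * t))"

text \<open>
  The value is only meaningful if the sequence given by the matrix is square summable, as it is
  for every bounded measurable symbol; Laurent polynomials are treated in
  \<open>coord_toeplitz_laurent_poly\<close> below.
\<close>

definition toeplitz :: "(complex \<Rightarrow> complex) \<Rightarrow> ell2 \<Rightarrow> ell2"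
  where "toeplitz f x = Abs_ell2 (\<lambda>i. \<Sum>j. fourier_coeff f (int i - int j) * coord x j)"

definition laurent_poly :: "nat \<Rightarrow> nat \<Rightarrow> (int \<Rightarrow> complex) \<Rightarrow> complex \<Rightarrow> complex"
  where "laurent_poly m k b z = (\<Sum>j = - int m..int k. b j * z powi j)"

lemma integral_cis_int:
  "((\<lambda>t. cis (of_int n * t)) has_integral (if n = 0 then complex_of_real (2 * pi) else 0)) {0..2 * pi}"
proof (cases "n = 0")
  case True
  then show ?thesis
    using has_integral_const_real[of "1 :: complex" 0 "2 * pi"] by (simp add: scaleR_conv_of_real)
next
  case False
  define F where "F = (\<lambda>t. cis (of_int n * t) / (\<i> * of_int n))"
  have "((\<lambda>z. exp (\<i> * of_int n * z) / (\<i> * of_int n)) has_field_derivative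
      exp (\<i> * of_int n * of_real t)) (at (of_real t))" for t :: real
    using False by (auto intro!: derivative_eq_intros)
  from has_vector_derivative_real_field[OF this]
  have "(F has_vector_derivative cis (of_int n * t)) (at t within {0..2 * pi})" for t
    unfolding F_def cis_conv_exp by (simp add: mult.assoc)
  then have "((\<lambda>t. cis (of_int n * t)) has_integral (F (2 * pi) - F 0)) {0..2 * pi}"
    by (intro fundamental_theorem_of_calculus) auto
  moreover have "F (2 * pi) = F 0"
    using cis_multiple_2pi[of "of_int n"] by (simp add: F_def mult_ac)
  ultimately show ?thesis using False by simp
qed

lemma fourier_coeff_laurent_poly:
  "fourier_coeff (laurent_poly m k b) n = (if n \<in> {- int m..int k} then b n else 0)"
proof -
  have "((\<lambda>t. \<Sum>j = - int m..int k. b j * cis (of_int (j - n) * t)) has_integral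
      (\<Sum>j = - int m..int k. b j * (if j - n = 0 then complex_of_real (2 * pi) else 0))) {0..2 * pi}"
    by (intro has_integral_sum has_integral_mult_right integral_cis_int) simp
  moreover have "laurent_poly m k b (cis t) * cis (- of_int n * t)
      = (\<Sum>j = - int m..int k. b j * cis (of_int (j - n) * t))" for t
    unfolding laurent_poly_def sum_distrib_right
    by (intro sum.cong) (simp_all add: cis_power_int mult.assoc cis_mult left_diff_distrib)
  moreover have "(\<Sum>j = - int m..int k. b j * (if j - n = 0 then complex_of_real (2 * pi) else 0))
      = (if n \<in> {- int m..int k} then b n * complex_of_real (2 * pi) else 0)"
    using sum.delta[of "{- int m..int k}" n "\<lambda>j. b j * complex_of_real (2 * pi)"]
    by (simp add: if_distrib[of "\<lambda>u. _ * u"] cong: if_cong)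
  ultimately show ?thesis
    unfolding fourier_coeff_def by (simp add: integral_unique)
qed

lemma square_summable_shift:
  fixes x :: "nat \<Rightarrow> complex"
  assumes "summable (\<lambda>n. (cmod (x n))\<^sup>2)"
  shows "summable (\<lambda>i. (cmod (if d \<le> int i then x (nat (int i - d)) else 0))\<^sup>2)"
proof (cases "d \<ge> 0")
  case True
  have "summable (\<lambda>i. (cmod (if d \<le> int (i + nat d) then x (nat (int (i + nat d) - d)) else 0))\<^sup>2)"
    using assms True by simp
  then show ?thesis by (subst (asm) summable_iff_shift)
next
  case False
  then have "(\<lambda>i. (cmod (if d \<le> int i then x (nat (int i - d)) else 0))\<^sup>2)
      = (\<lambda>i. (cmod (x (i + nat (- d))))\<^sup>2)"
    by (auto simp: fun_eq_iff nat_add_distrib[of "int _" "- d", simplified])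
  then show ?thesis
    using assms summable_iff_shift[of "\<lambda>n. (cmod (x n))\<^sup>2" "nat (- d)"] by simp
qed

lemma coord_toeplitz_laurent_poly:
  "coord (toeplitz (laurent_poly m k b) x) i =
    (\<Sum>d = - int m..int k. b d * (if d \<le> int i then coord x (nat (int i - d)) else 0))"
proof -
  let ?g = "\<lambda>i. \<Sum>d = - int m..int k. b d * (if d \<le> int i then coord x (nat (int i - d)) else 0)"
  have "(\<Sum>j. fourier_coeff (laurent_poly m k b) (int i - int j) * coord x j) = ?g i" for i
  proof -
    let ?J = "{j. int i - int j \<in> {- int m..int k}}"
    have "finite ?J" by (rule finite_subset[of _ "{..i + m}"]) auto
    then have "(\<Sum>j. fourier_coeff (laurent_poly m k b) (int i - int j) * coord x j)
        = (\<Sum>j\<in>?J. fourier_coeff (laurent_poly m k b) (int i - int j) * coord x j)"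
      by (rule suminf_finite) (auto simp: fourier_coeff_laurent_poly)
    also have "\<dots> = (\<Sum>j\<in>?J. b (int i - int j) * coord x j)"
      by (intro sum.cong) (auto simp: fourier_coeff_laurent_poly)
    also have "\<dots> = (\<Sum>d\<in>{d \<in> {- int m..int k}. d \<le> int i}. b d * coord x (nat (int i - d)))"
      by (rule sum.reindex_bij_witness[of _ "\<lambda>d. nat (int i - d)" "\<lambda>j. int i - int j"]) auto
    also have "\<dots> = ?g i"
      by (subst sum.inter_filter) (auto intro!: sum.cong)
    finally show ?thesis .
  qed
  moreover have "summable (\<lambda>i. (cmod (?g i))\<^sup>2)"
  proof -
    have "summable (\<lambda>i. (cmod (\<Sum>d\<in>D. b d *
        (if d \<le> int i then coord x (nat (int i - d)) else 0)))\<^sup>2)" if "finite D" for D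
      using that
      by (induction D) (auto intro!: square_summable_add square_summable_mult
          square_summable_shift summable_coord)
    then show ?thesis by simp
  qed
  ultimately show ?thesis
    unfolding toeplitz_def by (simp add: Abs_ell2_inverse)
qed

end

theory Submission
  imports Defs "HOL-Computational_Algebra.Fundamental_Theorem_Algebra"
    "HOL-Computational_Algebra.Polynomial_FPS"
begin

text \<open>
  Let \<open>d\<close> be the distance of \<open>w\<close> to the spectrum. For large \<open>\<bar>w\<bar>\<close> the resolvent is bounded by a
  constant times \<open>1/d\<close>, because \<open>w\<close> dominates the operator (\<open>resolvent_bound_far_away\<close>). On a
  bounded set of \<open>w\<close> a bound by a constant times \<open>1/d\<^sup>2\<close> is enough, and it comes from the Wiener-Hopf
  factorization of the symbol (\<open>resolvent_bound_on_bounded_set\<close>).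

  Write \<open>b(z) - w = z\<^sup>-\<^sup>m P(z)\<close> with a polynomial \<open>P\<close> of degree \<open>m + k\<close>. Under the identification of
  sequences with power series, \<open>T - w\<close> multiplies by \<open>P\<close> and then drops the first \<open>m\<close> coefficients
  (\<open>toeplitz_minus_eq\<close>). When \<open>T - w\<close> is bijective, \<open>P = q r\<close> where \<open>q\<close> is monic with exactly \<open>m\<close>
  roots, all in the open unit disc, and the \<open>k\<close> roots of \<open>r\<close> lie outside the closed disc: a root on
  the circle contradicts surjectivity (\<open>surj_imp_no_unit_root\<close>), and so do more than \<open>m\<close> roots
  inside (\<open>surj_imp_degree_le\<close>), while more than \<open>k\<close> roots outside produce a kernel
  (\<open>inj_imp_degree_ge\<close>). This elementary count takes the place of winding numbers and Fredholm indices.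

  Thus \<open>T - w\<close> is multiplication by \<open>r\<close> followed by the operator with coanalytic symbol \<open>z\<^sup>-\<^sup>m q\<close>.
  The first is bounded below by the minimum of \<open>\<bar>r\<bar>\<close> on the circle, by Parseval's identity
  (\<open>poly_mult_lower_bound\<close>); the second by the minimum of \<open>\<bar>q\<bar>\<close>, by passing to the transpose
  (\<open>left_shift_poly_mult_lower_bound\<close>). Since the values of \<open>b\<close> on the circle belong to the spectrum,
  \<open>\<bar>q r\<bar> = \<bar>b - w\<bar> \<ge> d\<close> there. Both \<open>\<bar>q\<bar>\<close> and \<open>\<bar>r\<bar>\<close> are bounded above while \<open>w\<close> stays bounded, so
  both minima are at least a constant times \<open>d\<close>. Finally \<open>d > 0\<close>, as the resolvent set is open.
\<close>

section \<open>Sequences as formal power series\<close>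

text \<open>
  A sequence is identified with the formal power series having it as coefficients, so that an
  analytic Toeplitz operator with polynomial symbol becomes multiplication of series and the
  backward shift becomes \<^const>\<open>fps_shift\<close>. All algebra takes place there.
\<close>

definition series :: "ell2 \<Rightarrow> complex fps"
  where "series x = Abs_fps (coord x)"

definition l2_fps :: "complex fps \<Rightarrow> bool"
  where "l2_fps F \<longleftrightarrow> summable (\<lambda>n. (cmod (fps_nth F n))\<^sup>2)"

definition ell2_of :: "complex fps \<Rightarrow> ell2"
  where "ell2_of F = Abs_ell2 (fps_nth F)"

lemma nth_series [simp]: "fps_nth (series x) n = coord x n"
  by (simp add: series_def)

lemma l2_series [simp]: "l2_fps (series x)"
  by (simp add: l2_fps_def summable_coord)

lemma coord_ell2_of: "l2_fps F \<Longrightarrow> coord (ell2_of F) n = fps_nth F n"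
  by (simp add: ell2_of_def l2_fps_def Abs_ell2_inverse)

lemma series_ell2_of: "l2_fps F \<Longrightarrow> series (ell2_of F) = F"
  by (rule fps_ext) (simp add: coord_ell2_of)

lemma series_inject [simp]: "series x = series y \<longleftrightarrow> x = y"
  by (metis ell2_eqI nth_series)

lemma series_add: "series (x + y) = series x + series y"
  and series_diff: "series (x - y) = series x - series y"
  and series_scaleC: "series (c *\<^sub>C x) = fps_const c * series x"
  and series_zero: "series 0 = 0"
  by (rule fps_ext; simp add: plus_ell2.rep_eq minus_ell2.rep_eq scaleC.rep_eq zero_ell2.rep_eq)+

lemma l2_fps_zero [simp]: "l2_fps 0"
  by (simp add: l2_fps_def)

lemma l2_fps_add: "l2_fps F \<Longrightarrow> l2_fps G \<Longrightarrow> l2_fps (F + G)"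
  unfolding l2_fps_def by (simp add: square_summable_add)

lemma l2_fps_cmult: "l2_fps F \<Longrightarrow> l2_fps (fps_const c * F)"
  unfolding l2_fps_def by (simp add: square_summable_mult)

lemma l2_fps_X_mult: "l2_fps F \<Longrightarrow> l2_fps (fps_X * F)"
  unfolding l2_fps_def
  by (subst summable_Suc_iff[symmetric]) simp

lemma l2_fps_poly_mult: "l2_fps F \<Longrightarrow> l2_fps (fps_of_poly p * F)"
proof (induction p)
  case (pCons a p)
  have "fps_of_poly (pCons a p) * F = fps_const a * F + fps_X * (fps_of_poly p * F)"
    by (simp add: fps_of_poly_pCons algebra_simps)
  then show ?case
    using pCons by (simp add: l2_fps_add l2_fps_cmult l2_fps_X_mult)
qed simp

lemma l2_fps_shift: "l2_fps F \<Longrightarrow> l2_fps (fps_shift m F)"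
  unfolding l2_fps_def using summable_iff_shift[of "\<lambda>n. (cmod (fps_nth F n))\<^sup>2" m] by simp

lemma L2_set_coord_le_norm: "L2_set (\<lambda>n. cmod (coord x n)) {..<N} \<le> norm x"
  unfolding L2_set_def norm_ell2_def
  by (intro real_sqrt_le_mono sum_le_suminf summable_coord) auto

lemma l2_fps_bounded:
  assumes "\<And>N. L2_set (\<lambda>n. cmod (fps_nth F n)) {..<N} \<le> K"
  shows "l2_fps F" and "norm (ell2_of F) \<le> K"
proof -
  have K: "0 \<le> K" using assms[of 0] by simp
  have *: "(\<Sum>n<N. (cmod (fps_nth F n))\<^sup>2) \<le> K\<^sup>2" for N
    using assms[of N] K unfolding L2_set_def by (simp add: real_sqrt_le_iff' sqrt_le_D)
  show l2: "l2_fps F"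
    unfolding l2_fps_def
    by (rule summableI_nonneg_bounded[where x = "K\<^sup>2"]) (use * in auto)
  have "(\<Sum>n. (cmod (fps_nth F n))\<^sup>2) \<le> K\<^sup>2"
    by (rule suminf_le_const) (use l2 * in \<open>auto simp: l2_fps_def\<close>)
  then show "norm (ell2_of F) \<le> K"
    using K l2 by (simp add: norm_ell2_def coord_ell2_of real_le_lsqrt)
qed

lemma norm_ell2_le:
  assumes "\<And>N. L2_set (\<lambda>n. cmod (coord x n)) {..<N} \<le> K"
  shows "norm x \<le> K"
proof -
  have "ell2_of (series x) = x"
    by (metis l2_series series_ell2_of series_inject)
  with l2_fps_bounded(2)[of "series x" K] assms show ?thesis by simp
qed

lemma norm_coord_le: "cmod (coord x n) \<le> norm x"
proof -
  have "cmod (coord x n) \<le> L2_set (\<lambda>n. cmod (coord x n)) {..<Suc n}"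
    by (rule member_le_L2_set) auto
  then show ?thesis
    using L2_set_coord_le_norm order_trans by blast
qed

lemma norm_scaleC: "norm (c *\<^sub>C x) = cmod c * norm x"
  using suminf_mult[OF summable_coord[of x], of "(cmod c)\<^sup>2"]
  by (simp add: norm_ell2_def scaleC.rep_eq norm_mult power_mult_distrib real_sqrt_mult)

definition poly_mult :: "complex poly \<Rightarrow> ell2 \<Rightarrow> ell2"
  where "poly_mult p x = ell2_of (fps_of_poly p * series x)"

definition left_shift :: "nat \<Rightarrow> ell2 \<Rightarrow> ell2"
  where "left_shift m x = ell2_of (fps_shift m (series x))"

lemma series_poly_mult [simp]: "series (poly_mult p x) = fps_of_poly p * series x"
  by (simp add: poly_mult_def series_ell2_of l2_fps_poly_mult)

lemma series_left_shift [simp]: "series (left_shift m x) = fps_shift m (series x)"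
  by (simp add: left_shift_def series_ell2_of l2_fps_shift)

lemma coord_left_shift [simp]: "coord (left_shift m x) n = coord x (n + m)"
  by (metis fps_shift_nth nth_series series_left_shift)

lemma left_shift_add: "left_shift m (x + y) = left_shift m x + left_shift m y"
  and left_shift_scaleC: "left_shift m (c *\<^sub>C x) = c *\<^sub>C left_shift m x"
  by (rule ell2_eqI, simp add: plus_ell2.rep_eq scaleC.rep_eq)+

lemma norm_left_shift_le: "norm (left_shift m x) \<le> norm x"
proof (rule norm_ell2_le)
  fix N
  have "L2_set (\<lambda>n. cmod (coord (left_shift m x) n)) {..<N}
      = sqrt (\<Sum>n\<in>(\<lambda>n. n + m) ` {..<N}. (cmod (coord x n))\<^sup>2)"
    unfolding L2_set_def by (subst sum.reindex) auto
  also have "\<dots> \<le> L2_set (\<lambda>n. cmod (coord x n)) {..<N + m}"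
    unfolding L2_set_def by (intro real_sqrt_le_mono sum_mono2) auto
  finally show "L2_set (\<lambda>n. cmod (coord (left_shift m x) n)) {..<N} \<le> norm x"
    using L2_set_coord_le_norm order_trans by blast
qed

lemma poly_mult_0: "poly_mult 0 x = 0"
  by (subst series_inject[symmetric]) (simp add: series_zero)

lemma poly_mult_mult: "poly_mult (p * q) x = poly_mult p (poly_mult q x)"
  by (subst series_inject[symmetric]) (simp add: fps_of_poly_mult mult.assoc)

lemma poly_mult_pCons: "poly_mult (pCons a p) x = a *\<^sub>C x + poly_mult [:0, 1:] (poly_mult p x)"
  by (subst series_inject[symmetric])
    (simp add: series_add series_scaleC fps_of_poly_pCons algebra_simps)

lemma poly_mult_add: "poly_mult p (x + y) = poly_mult p x + poly_mult p y"
  and poly_mult_scaleC: "poly_mult p (c *\<^sub>C x) = c *\<^sub>C poly_mult p x"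
  by (subst series_inject[symmetric], simp add: series_add series_scaleC algebra_simps)+

lemma poly_mult_diff: "poly_mult p (x - y) = poly_mult p x - poly_mult p y"
  by (subst series_inject[symmetric]) (simp add: series_diff algebra_simps)

lemma norm_right_shift: "norm (poly_mult [:0, 1:] x) = norm x"
proof -
  have [simp]: "coord (poly_mult [:0, 1:] x) n = (if n = 0 then 0 else coord x (n - 1))" for n
    by (metis fps_X_mult_nth fps_of_poly_fps_X nth_series series_poly_mult)
  show ?thesis
    using suminf_split_head[OF summable_coord[of "poly_mult [:0, 1:] x"]]
    by (simp add: norm_ell2_def)
qed

lemma poly_mult_bounded: "\<exists>K\<ge>0. \<forall>x. norm (poly_mult p x) \<le> K * norm x"
proof (induction p)
  case (pCons a p)
  then obtain K where K: "K \<ge> 0" "\<And>x. norm (poly_mult p x) \<le> K * norm x" by blast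
  have "norm (poly_mult (pCons a p) x) \<le> (cmod a + K) * norm x" for x
    by (subst poly_mult_pCons, unfold distrib_right, rule norm_triangle_le)
      (simp add: norm_right_shift norm_scaleC K)
  with K show ?case by (intro exI[of _ "cmod a + K"]) simp
qed (auto simp: poly_mult_0)

section \<open>The lower bound from Parseval\<close>

definition ell2_of_poly :: "complex poly \<Rightarrow> ell2"
  where "ell2_of_poly p = ell2_of (fps_of_poly p)"

lemma l2_fps_of_poly: "l2_fps (fps_of_poly p)"
  unfolding l2_fps_def
  by (rule summable_finite[of "{..degree p}"]) (auto simp: coeff_eq_0)

lemma series_ell2_of_poly [simp]: "series (ell2_of_poly p) = fps_of_poly p"
  by (simp add: ell2_of_poly_def series_ell2_of l2_fps_of_poly)

lemma norm_ell2_of_poly: "(norm (ell2_of_poly p))\<^sup>2 = (\<Sum>n\<le>degree p. (cmod (coeff p n))\<^sup>2)"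
proof -
  have c: "coord (ell2_of_poly p) n = coeff p n" for n
    by (metis fps_of_poly_nth nth_series series_ell2_of_poly)
  have "(\<Sum>n. (cmod (coeff p n))\<^sup>2) = (\<Sum>n\<le>degree p. (cmod (coeff p n))\<^sup>2)"
    by (rule suminf_finite) (auto simp: coeff_eq_0)
  then show ?thesis
    by (simp add: norm_ell2_def c sum_nonneg)
qed

text \<open>
  On the circle \<open>\<bar>p\<bar>\<^sup>2\<close> is \<open>p\<close> times its conjugate, a trigonometric polynomial in which only the
  diagonal terms have a non-zero integral.
\<close>

lemma parseval_poly:
  "((\<lambda>t. (cmod (poly p (cis t)))\<^sup>2) has_integral 2 * pi * (norm (ell2_of_poly p))\<^sup>2) {0..2 * pi}"
proof -
  let ?c = "coeff p" and ?D = "{..degree p}"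
  have "((\<lambda>t. \<Sum>i\<in>?D. \<Sum>j\<in>?D. ?c i * cnj (?c j) * cis (of_int (int i - int j) * t)) has_integral
      (\<Sum>i\<in>?D. \<Sum>j\<in>?D. ?c i * cnj (?c j) * (if int i - int j = 0 then complex_of_real (2 * pi) else 0)))
      {0..2 * pi}"
    by (intro has_integral_sum has_integral_mult_right integral_cis_int) auto
  also have "(\<Sum>i\<in>?D. \<Sum>j\<in>?D. ?c i * cnj (?c j) * (if int i - int j = 0 then complex_of_real (2 * pi) else 0))
      = complex_of_real (2 * pi * (norm (ell2_of_poly p))\<^sup>2)"
    unfolding norm_ell2_of_poly
    by (simp add: if_distrib[of "\<lambda>u. _ * u"] sum_distrib_left sum.delta complex_norm_square mult_ac
        del: of_real_power cong: if_cong)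
  also have "(\<lambda>t. \<Sum>i\<in>?D. \<Sum>j\<in>?D. ?c i * cnj (?c j) * cis (of_int (int i - int j) * t))
      = (\<lambda>t. complex_of_real ((cmod (poly p (cis t)))\<^sup>2))"
  proof
    fix t :: real
    have "complex_of_real ((cmod (poly p (cis t)))\<^sup>2) = poly p (cis t) * cnj (poly p (cis t))"
      by (rule complex_norm_square)
    also have "\<dots> = (\<Sum>i\<in>?D. \<Sum>j\<in>?D. (?c i * cis t ^ i) * cnj (?c j * cis t ^ j))"
      by (simp add: poly_altdef sum_product)
    also have "\<dots> = (\<Sum>i\<in>?D. \<Sum>j\<in>?D. ?c i * cnj (?c j) * cis (of_int (int i - int j) * t))"
      by (intro sum.cong refl)
        (simp add: Complex.DeMoivre cis_cnj cis_mult algebra_simps flip: mult.assoc)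
    finally show "(\<Sum>i\<in>?D. \<Sum>j\<in>?D. ?c i * cnj (?c j) * cis (of_int (int i - int j) * t))
      = complex_of_real ((cmod (poly p (cis t)))\<^sup>2)" ..
  qed
  finally have "((\<lambda>t. complex_of_real ((cmod (poly p (cis t)))\<^sup>2)) has_integral
      complex_of_real (2 * pi * (norm (ell2_of_poly p))\<^sup>2)) {0..2 * pi}" .
  from has_integral_linear[OF this bounded_linear_Re] show ?thesis
    by (simp add: o_def)
qed

lemma poly_mult_ell2_of_poly: "poly_mult p (ell2_of_poly q) = ell2_of_poly (p * q)"
  by (subst series_inject[symmetric]) (simp add: fps_of_poly_mult)

lemma poly_mult_lower_bound_poly:
  assumes "\<And>z. cmod z = 1 \<Longrightarrow> \<beta> \<le> cmod (poly p z)" and "\<beta> \<ge> 0"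
  shows "\<beta> * norm (ell2_of_poly q) \<le> norm (poly_mult p (ell2_of_poly q))"
proof -
  have "\<beta>\<^sup>2 * (2 * pi * (norm (ell2_of_poly q))\<^sup>2) \<le> 2 * pi * (norm (ell2_of_poly (p * q)))\<^sup>2"
  proof (rule has_integral_le[OF has_integral_mult_right[OF parseval_poly] parseval_poly])
    fix t
    show "\<beta>\<^sup>2 * (cmod (poly q (cis t)))\<^sup>2 \<le> (cmod (poly (p * q) (cis t)))\<^sup>2"
      using assms by (simp add: norm_mult power_mult_distrib mult_right_mono power_mono)
  qed
  then have "(\<beta> * norm (ell2_of_poly q))\<^sup>2 \<le> (norm (ell2_of_poly (p * q)))\<^sup>2"
    using pi_gt_zero by (simp add: power_mult_distrib)
  then show ?thesis
    unfolding poly_mult_ell2_of_poly by (rule power2_le_imp_le) simp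
qed

lemma truncations_tendsto: "(\<lambda>N. ell2_of_poly (truncate_fps N (series x))) \<longlonglongrightarrow> x"
proof -
  let ?f = "\<lambda>n. (cmod (coord x n))\<^sup>2"
  have "norm (ell2_of_poly (truncate_fps N (series x)) - x) = sqrt (\<Sum>n. ?f (n + N))" for N
  proof -
    have c: "coord (ell2_of_poly (truncate_fps N (series x)) - x) n = (if n < N then 0 else - coord x n)" for n
      by (simp add: minus_ell2.rep_eq flip: nth_series)
    let ?g = "\<lambda>n. (cmod (coord (ell2_of_poly (truncate_fps N (series x)) - x) n))\<^sup>2"
    have "(\<Sum>n. ?g n) = (\<Sum>n. ?g (n + N)) + (\<Sum>n<N. ?g n)"
      by (rule suminf_split_initial_segment[OF summable_coord])
    then show ?thesis by (simp add: norm_ell2_def c)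
  qed
  moreover have "(\<lambda>N. sqrt (\<Sum>n. ?f (n + N))) \<longlonglongrightarrow> sqrt 0"
  proof (intro tendsto_real_sqrt)
    have "(\<lambda>N. suminf ?f - sum ?f {..<N}) \<longlonglongrightarrow> suminf ?f - suminf ?f"
      by (intro tendsto_diff tendsto_const summable_LIMSEQ summable_coord)
    then show "(\<lambda>N. \<Sum>n. ?f (n + N)) \<longlonglongrightarrow> 0"
      by (simp add: suminf_minus_initial_segment[OF summable_coord])
  qed
  ultimately show ?thesis
    by (subst Lim_null) (auto intro: tendsto_norm_zero_cancel)
qed

lemma poly_mult_tendsto:
  assumes "f \<longlonglongrightarrow> x"
  shows "(\<lambda>n. poly_mult p (f n)) \<longlonglongrightarrow> poly_mult p x"
proof -
  obtain K where K: "\<And>x. norm (poly_mult p x) \<le> K * norm x"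
    using poly_mult_bounded by blast
  have "(\<lambda>n. f n - x) \<longlonglongrightarrow> 0"
    using assms Lim_null by blast
  then have "(\<lambda>n. poly_mult p (f n) - poly_mult p x) \<longlonglongrightarrow> 0"
    by (rule tendsto_0_le[where K = K]) (simp add: K mult.commute flip: poly_mult_diff)
  then show ?thesis
    using Lim_null by blast
qed

text \<open>
  Multiplication by \<open>p\<close> is multiplication of functions on the circle, so it is bounded below by
  the minimum of \<open>\<bar>p\<bar>\<close> there. Parseval's identity gives this for polynomials; truncations carry it
  over to the closure, which is the whole space.
\<close>

lemma poly_mult_lower_bound:
  assumes "\<And>z. cmod z = 1 \<Longrightarrow> \<beta> \<le> cmod (poly p z)" and "\<beta> \<ge> 0"
  shows "\<beta> * norm x \<le> norm (poly_mult p x)"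
proof (rule LIMSEQ_le)
  let ?x = "\<lambda>N. ell2_of_poly (truncate_fps N (series x))"
  show "(\<lambda>N. \<beta> * norm (?x N)) \<longlonglongrightarrow> \<beta> * norm x"
    by (intro tendsto_intros truncations_tendsto)
  show "(\<lambda>N. norm (poly_mult p (?x N))) \<longlonglongrightarrow> norm (poly_mult p x)"
    by (intro tendsto_norm poly_mult_tendsto truncations_tendsto)
  show "\<exists>N. \<forall>n\<ge>N. \<beta> * norm (?x n) \<le> norm (poly_mult p (?x n))"
    using poly_mult_lower_bound_poly[OF assms] by blast
qed

section \<open>Division by polynomials within the square summable series\<close>

lemma complex_poly_root_induct [consumes 1, case_names const factor]:
  fixes p :: "complex poly"
  assumes "p \<noteq> 0"
    and const: "\<And>c. c \<noteq> 0 \<Longrightarrow> P [:c:]"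
    and factor: "\<And>a p. p \<noteq> 0 \<Longrightarrow> P p \<Longrightarrow> P ([:- a, 1:] * p)"
  shows "P p"
  using assms(1)
proof (induction "degree p" arbitrary: p)
  case 0
  then show ?case by (metis const degree_eq_zeroE pCons_0_0)
next
  case (Suc n)
  then obtain a where "poly p a = 0"
    using alg_closed_imp_poly_has_root[of p] by auto
  then obtain q where q: "p = [:- a, 1:] * q"
    by (auto simp: poly_eq_0_iff_dvd elim: dvdE)
  with Suc.prems have "q \<noteq> 0" by auto
  with Suc.hyps(2) q have "n = degree q"
    by (simp add: degree_mult_eq del: mult_pCons_left)
  with Suc.hyps(1) \<open>q \<noteq> 0\<close> q factor show ?case by blast
qed

lemma nth_linear_mult:
  "fps_nth (fps_of_poly [:c, e:] * F) n = c * fps_nth F n + (if n = 0 then 0 else e * fps_nth F (n - 1))"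
  for F :: "complex fps"
proof -
  have "fps_of_poly [:c, e:] * F = fps_const c * F + fps_X * (fps_const e * F)"
    by (simp add: fps_of_poly_pCons algebra_simps)
  then show ?thesis by simp
qed

text \<open>
  The constant term dominates, so \<open>c V\<^sub>n = W\<^sub>n - e V\<^sub>n\<^sub>-\<^sub>1\<close> can be solved for the norm of an initial
  segment of \<open>V\<close> before \<open>V\<close> is known to have finite norm.
\<close>

lemma l2_fps_linear_factor:
  assumes "cmod e < cmod c" and l2: "l2_fps (fps_of_poly [:c, e:] * V)"
  shows "l2_fps V"
proof (rule l2_fps_bounded(1))
  fix N
  let ?W = "fps_of_poly [:c, e:] * V"
  define V' where "V' n = (if n = 0 then 0 else fps_nth V (n - 1))" for n
  let ?S = "L2_set (\<lambda>n. cmod (fps_nth V n)) {..<N}"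
  have "(\<Sum>n<N. (cmod (V' n))\<^sup>2) \<le> (\<Sum>n<N. (cmod (fps_nth V n))\<^sup>2)"
  proof (cases N)
    case (Suc M)
    have "(\<Sum>n<N. (cmod (V' n))\<^sup>2) = (\<Sum>n<M. (cmod (fps_nth V n))\<^sup>2)"
      unfolding Suc sum.lessThan_Suc_shift by (simp add: V'_def)
    then show ?thesis by (simp add: Suc)
  qed simp
  then have shift: "L2_set (\<lambda>n. cmod (V' n)) {..<N} \<le> ?S"
    unfolding L2_set_def by simp
  have "cmod c * ?S = L2_set (\<lambda>n. cmod c * cmod (fps_nth V n)) {..<N}"
    by (simp add: L2_set_right_distrib)
  also have "\<dots> \<le> L2_set (\<lambda>n. cmod (fps_nth ?W n) + cmod e * cmod (V' n)) {..<N}"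
  proof (rule L2_set_mono)
    fix n
    have "c * fps_nth V n = fps_nth ?W n - e * V' n"
      unfolding nth_linear_mult V'_def by simp
    then show "cmod c * cmod (fps_nth V n) \<le> cmod (fps_nth ?W n) + cmod e * cmod (V' n)"
      by (metis norm_mult norm_triangle_ineq4)
  qed simp
  also have "\<dots> \<le> L2_set (\<lambda>n. cmod (fps_nth ?W n)) {..<N} + cmod e * L2_set (\<lambda>n. cmod (V' n)) {..<N}"
    by (rule order_trans[OF L2_set_triangle_ineq]) (simp add: L2_set_right_distrib)
  also have "\<dots> \<le> norm (ell2_of ?W) + cmod e * ?S"
    using L2_set_coord_le_norm[of "ell2_of ?W" N] shift
    by (intro add_mono mult_left_mono) (auto simp: coord_ell2_of[OF l2])
  finally show "?S \<le> norm (ell2_of ?W) / (cmod c - cmod e)"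
    using assms(1) by (simp add: pos_le_divide_eq algebra_simps)
qed

text \<open>
  The formal quotient by a polynomial without roots in the closed disc stays square summable. This
  replaces the inversion of an outer factor.
\<close>

lemma l2_fps_divide_poly:
  assumes "p \<noteq> 0" "\<And>z. poly p z = 0 \<Longrightarrow> 1 < cmod z" "l2_fps (fps_of_poly p * V)"
  shows "l2_fps V"
  using assms
proof (induction p arbitrary: V rule: complex_poly_root_induct)
  case (const c)
  then have "l2_fps (fps_const (inverse c) * (fps_const c * V))"
    by - (rule l2_fps_cmult, simp add: fps_of_poly_const)
  then show ?case
    using const(1) by (simp flip: mult.assoc)
next
  case (factor a p)
  have "l2_fps (fps_of_poly [:- a, 1:] * (fps_of_poly p * V))"
    using "factor.prems"(2) by (simp add: fps_of_poly_mult mult.assoc del: mult_pCons_left)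
  then have "l2_fps (fps_of_poly p * V)"
    by (rule l2_fps_linear_factor[rotated]) (use "factor.prems"(1)[of a] in simp)
  with factor show ?case by (simp del: mult_pCons_left)
qed

text \<open>
  Beyond the degree of a product \<open>(z - a) W\<close> the coefficients satisfy \<open>W\<^sub>n = a W\<^sub>n\<^sub>+\<^sub>1\<close>. For
  \<open>\<bar>a\<bar> \<le> 1\<close> their moduli do not decrease, and a null sequence with this property is zero. So each
  root lowers the degree by one, as for polynomials; roots on the circle are covered.
\<close>

lemma poly_divide_vanishing:
  assumes "p \<noteq> 0" "\<And>z. poly p z = 0 \<Longrightarrow> cmod z \<le> 1" "l2_fps V"
    and "\<And>n. n \<ge> N \<Longrightarrow> fps_nth (fps_of_poly p * V) n = 0" "n \<ge> N - degree p"
  shows "fps_nth V n = 0"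
  using assms
proof (induction p arbitrary: N n rule: complex_poly_root_induct)
  case (const c)
  then show ?case by (auto simp: fps_of_poly_const)
next
  case (factor a p)
  define W where "W = fps_of_poly p * V"
  have W: "l2_fps W"
    by (simp add: W_def l2_fps_poly_mult \<open>l2_fps V\<close>)
  have a: "cmod a \<le> 1" using "factor.prems"(1)[of a] by simp
  have rec: "fps_nth W n = a * fps_nth W (Suc n)" if "Suc n \<ge> N" for n
    using "factor.prems"(3)[OF that] nth_linear_mult[of "- a" 1 W "Suc n"]
    by (simp add: fps_of_poly_mult mult.assoc W_def[symmetric] del: mult_pCons_left)
  have mono: "cmod (fps_nth W n) \<le> cmod (fps_nth W (n + j))" if "Suc n \<ge> N" for n j
  proof (induction j)
    case (Suc j)
    have "cmod (fps_nth W (n + j)) \<le> 1 * cmod (fps_nth W (Suc (n + j)))"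
      using that a by (subst rec) (auto simp: norm_mult intro!: mult_left_le_one_le)
    with Suc show ?case by simp
  qed simp
  have "fps_nth W n = 0" if "n \<ge> N - 1" for n
  proof -
    have "(\<lambda>j. (cmod (fps_nth W j))\<^sup>2) \<longlonglongrightarrow> 0"
      using W unfolding l2_fps_def by (rule summable_LIMSEQ_zero)
    then have "(\<lambda>j. cmod (fps_nth W j)) \<longlonglongrightarrow> 0"
      by simp
    then have "(\<lambda>j. cmod (fps_nth W (j + n))) \<longlonglongrightarrow> 0"
      by (rule LIMSEQ_ignore_initial_segment)
    then have "cmod (fps_nth W n) \<le> 0"
      by (rule LIMSEQ_le_const) (use that mono[of n] in \<open>auto simp: add.commute\<close>)
    then show ?thesis by simp
  qed
  moreover have "n \<ge> N - 1 - degree p"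
    using "factor.prems"(4) \<open>p \<noteq> 0\<close> by (simp add: degree_mult_eq del: mult_pCons_left)
  ultimately show ?case
    using "factor.IH"[of "N - 1" n] "factor.prems"(1,2) by (simp add: W_def del: mult_pCons_left)
qed

lemma poly_split_unit_disc:
  fixes p :: "complex poly"
  assumes "p \<noteq> 0"
  obtains q r where "p = q * r" "lead_coeff q = 1" "r \<noteq> 0"
    "\<And>z. poly q z = 0 \<Longrightarrow> cmod z \<le> 1" "\<And>z. poly r z = 0 \<Longrightarrow> 1 < cmod z"
proof -
  have "\<exists>q r. p = q * r \<and> lead_coeff q = 1 \<and> r \<noteq> 0 \<and>
      (\<forall>z. poly q z = 0 \<longrightarrow> cmod z \<le> 1) \<and> (\<forall>z. poly r z = 0 \<longrightarrow> 1 < cmod z)"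
    using assms
  proof (induction p rule: complex_poly_root_induct)
    case (const c)
    then show ?case by (intro exI[of _ 1] exI[of _ "[:c:]"]) auto
  next
    case (factor a p)
    then obtain q r where qr: "p = q * r" "lead_coeff q = 1" "r \<noteq> 0"
      "\<And>z. poly q z = 0 \<Longrightarrow> cmod z \<le> 1" "\<And>z. poly r z = 0 \<Longrightarrow> 1 < cmod z" by blast
    show ?case
    proof (cases "cmod a \<le> 1")
      case True
      then show ?thesis
        using qr by (intro exI[of _ "[:- a, 1:] * q"] exI[of _ r])
          (auto simp: lead_coeff_mult mult.assoc simp del: mult_pCons_left)
    next
      case False
      then show ?thesis
        using qr by (intro exI[of _ q] exI[of _ "[:- a, 1:] * r"])
          (auto simp: mult.left_commute simp del: mult_pCons_left)
    qed
  qed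
  with that show ?thesis by blast
qed

text \<open>
  Every linear factor contributes at most \<open>\<bar>z\<bar> + \<bar>a\<bar> \<le> 1 + M\<close>.
\<close>

lemma norm_poly_le_of_roots:
  fixes p :: "complex poly"
  assumes "p \<noteq> 0" "\<And>a. poly p a = 0 \<Longrightarrow> cmod a \<le> M" "cmod z \<le> 1"
  shows "cmod (poly p z) \<le> cmod (lead_coeff p) * (1 + M) ^ degree p"
  using assms
proof (induction p rule: complex_poly_root_induct)
  case (factor a p)
  have M: "cmod a \<le> M" using "factor.prems"(1)[of a] by simp
  have "cmod (z - a) \<le> 1 + M"
    using norm_triangle_ineq4[of z a] M \<open>cmod z \<le> 1\<close> by simp
  moreover have "cmod (poly p z) \<le> cmod (lead_coeff p) * (1 + M) ^ degree p"
    using factor by auto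
  ultimately have "cmod (z - a) * cmod (poly p z) \<le> (1 + M) * (cmod (lead_coeff p) * (1 + M) ^ degree p)"
    by (intro mult_mono order_trans[OF norm_ge_zero]) auto
  moreover have "poly ([:- a, 1:] * p) z = (z - a) * poly p z"
    by (simp add: algebra_simps)
  moreover have "degree ([:- a, 1:] * p) = Suc (degree p)" "lead_coeff ([:- a, 1:] * p) = lead_coeff p"
    using \<open>p \<noteq> 0\<close> degree_mult_eq[of "[:- a, 1:]" p] lead_coeff_mult[of "[:- a, 1:]" p] by simp_all
  ultimately show ?case
    by (simp only: norm_mult power_Suc mult_ac)
qed simp

section \<open>Coanalytic factors by transposition\<close>

lemma abs_summable_pairing:
  "summable (\<lambda>n. cmod (coord x n * coord y n))"
  and norm_pairing_le: "cmod (\<Sum>n. coord x n * coord y n) \<le> norm x * norm y"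
proof -
  have le: "(\<Sum>n<N. cmod (coord x n * coord y n)) \<le> norm x * norm y" for N
  proof -
    have "(\<Sum>n<N. cmod (coord x n * coord y n))
        \<le> L2_set (\<lambda>n. cmod (coord x n)) {..<N} * L2_set (\<lambda>n. cmod (coord y n)) {..<N}"
      using L2_set_mult_ineq[of "\<lambda>n. cmod (coord x n)" "\<lambda>n. cmod (coord y n)" "{..<N}"]
      by (simp add: norm_mult)
    also have "\<dots> \<le> norm x * norm y"
      by (intro mult_mono L2_set_coord_le_norm) auto
    finally show ?thesis .
  qed
  show s: "summable (\<lambda>n. cmod (coord x n * coord y n))"
    by (rule summableI_nonneg_bounded[OF _ le]) simp
  have "cmod (\<Sum>n. coord x n * coord y n) \<le> (\<Sum>n. cmod (coord x n * coord y n))"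
    by (rule summable_norm[OF s])
  also have "\<dots> \<le> norm x * norm y"
    by (rule suminf_le_const[OF s le])
  finally show "cmod (\<Sum>n. coord x n * coord y n) \<le> norm x * norm y" .
qed

lemma nth_poly_mult:
  fixes F :: "complex fps"
  assumes "degree p \<le> N"
  shows "fps_nth (fps_of_poly p * F) n = (\<Sum>i\<le>N. coeff p i * (if i \<le> n then fps_nth F (n - i) else 0))"
proof -
  have "fps_nth (fps_of_poly p * F) n = (\<Sum>i\<le>n. coeff p i * fps_nth F (n - i))"
    by (simp add: fps_mult_nth atMost_atLeast0)
  also have "\<dots> = (\<Sum>i\<le>max n N. coeff p i * (if i \<le> n then fps_nth F (n - i) else 0))"
    by (rule sum.mono_neutral_cong_left) auto
  also have "\<dots> = (\<Sum>i\<le>N. coeff p i * (if i \<le> n then fps_nth F (n - i) else 0))"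
    using assms by (intro sum.mono_neutral_right) (auto simp: coeff_eq_0)
  finally show ?thesis .
qed

lemma pairing_shift:
  "(\<lambda>n. coord x n * (if i \<le> n then coord y (n - i) else 0)) sums (\<Sum>n. coord x (n + i) * coord y n)"
proof -
  let ?f = "\<lambda>n. coord x n * (if i \<le> n then coord y (n - i) else 0)"
  have "(\<lambda>n. coord x (n + i) * coord y n) sums (\<Sum>n. coord x (n + i) * coord y n)"
    using abs_summable_pairing[of "left_shift i x" y] summable_norm_cancel by fastforce
  then have "(\<lambda>n. ?f (n + i)) sums (\<Sum>n. coord x (n + i) * coord y n)"
    by simp
  then show ?thesis
    by (subst (asm) sums_iff_shift) (auto simp: sum.neutral)
qed

text \<open>
  For the bilinear pairing \<open>\<Sum>n. x\<^sub>n y\<^sub>n\<close>, the transpose of a Toeplitz matrix has the symbol with \<open>z\<close>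
  and \<open>1/z\<close> exchanged. Multiplication by \<open>p\<close> followed by a left shift by \<open>m = degree p\<close> has the
  symbol \<open>z\<^sup>-\<^sup>m p(z)\<close>, hence its transpose is multiplication by the reflected polynomial.
\<close>

lemma pairing_reflect_poly:
  "(\<Sum>n. coord z n * coord (poly_mult (reflect_poly p) v) n)
    = (\<Sum>n. coord (left_shift (degree p) (poly_mult p z)) n * coord v n)"
proof -
  let ?m = "degree p" and ?r = "\<lambda>i. coeff p (degree p - i)"
  have 1: "coord (poly_mult (reflect_poly p) v) n = (\<Sum>i\<le>?m. ?r i * (if i \<le> n then coord v (n - i) else 0))" for n
  proof -
    have "coord (poly_mult (reflect_poly p) v) n = fps_nth (fps_of_poly (reflect_poly p) * series v) n"
      by (metis nth_series series_poly_mult)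
    also have "\<dots> = (\<Sum>i\<le>?m. coeff (reflect_poly p) i * (if i \<le> n then coord v (n - i) else 0))"
      by (simp add: nth_poly_mult[OF degree_reflect_poly_le] cong: if_cong)
    also have "\<dots> = (\<Sum>i\<le>?m. ?r i * (if i \<le> n then coord v (n - i) else 0))"
      by (intro sum.cong refl) (simp add: coeff_reflect_poly)
    finally show ?thesis .
  qed
  have 2: "coord (left_shift ?m (poly_mult p z)) n = (\<Sum>i\<le>?m. ?r i * coord z (n + i))" for n
  proof -
    have "coord (left_shift ?m (poly_mult p z)) n = fps_nth (fps_of_poly p * series z) (n + ?m)"
      by (metis nth_series series_poly_mult coord_left_shift)
    also have "\<dots> = (\<Sum>i\<le>?m. coeff p i * coord z (n + ?m - i))"
      by (simp add: nth_poly_mult[OF order_refl])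
    also have "\<dots> = (\<Sum>i\<le>?m. ?r i * coord z (n + i))"
      by (rule sum.reindex_bij_witness[of _ "\<lambda>i. ?m - i" "\<lambda>i. ?m - i"]) auto
    finally show ?thesis .
  qed
  have "(\<lambda>n. \<Sum>i\<le>?m. ?r i * (coord z n * (if i \<le> n then coord v (n - i) else 0)))
      sums (\<Sum>i\<le>?m. ?r i * (\<Sum>n. coord z (n + i) * coord v n))"
    by (intro sums_sum sums_mult pairing_shift)
  moreover have "(\<lambda>n. \<Sum>i\<le>?m. ?r i * (coord z (n + i) * coord v n))
      sums (\<Sum>i\<le>?m. ?r i * (\<Sum>n. coord z (n + i) * coord v n))"
    using abs_summable_pairing[of "left_shift _ z" v, THEN summable_norm_cancel]
    by (intro sums_sum sums_mult summable_sums) simp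
  ultimately have "(\<Sum>n. \<Sum>i\<le>?m. ?r i * (coord z n * (if i \<le> n then coord v (n - i) else 0)))
      = (\<Sum>n. \<Sum>i\<le>?m. ?r i * (coord z (n + i) * coord v n))"
    by (simp add: sums_iff)
  then show ?thesis
    unfolding 1 2 sum_distrib_left sum_distrib_right by (simp add: mult_ac)
qed

text \<open>
  The operator on the right has the coanalytic symbol \<open>z\<^sup>-\<^sup>m p(z)\<close>. The projection onto the
  nonnegative frequencies only decreases norms, so Parseval does not apply to it directly. Its
  transpose is multiplication by the reflected polynomial, which is invertible as its roots lie
  outside the closed disc, and has the same modulus on the circle up to conjugation of the argument;
  the bound for the transpose passes to the operator by duality.
\<close>

lemma left_shift_poly_mult_lower_bound:
  assumes "p \<noteq> 0" and roots: "\<And>z. poly p z = 0 \<Longrightarrow> cmod z < 1"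
    and \<alpha>: "\<And>z. cmod z = 1 \<Longrightarrow> \<alpha> \<le> cmod (poly p z)" "\<alpha> \<ge> 0"
  shows "\<alpha> * norm z \<le> norm (left_shift (degree p) (poly_mult p z))"
proof (cases "z = 0")
  case False
  let ?r = "reflect_poly p" and ?y = "left_shift (degree p) (poly_mult p z)"
  define F where "F = Abs_fps (\<lambda>n. cnj (coord z n))"
  have F: "l2_fps F"
    using l2_series[of z] by (simp add: l2_fps_def F_def)
  have r0: "coeff ?r 0 \<noteq> 0" using \<open>p \<noteq> 0\<close> by simp
  \<comment> \<open>The preimage of the conjugate of \<open>z\<close> under the transpose; pairing with it recovers \<open>norm z\<close>.\<close>
  define V where "V = inverse (fps_of_poly ?r) * F"
  have V: "fps_of_poly ?r * V = F"
    using r0 inverse_mult_eq_1'[of "fps_of_poly ?r"] by (simp add: V_def flip: mult.assoc)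
  have "l2_fps V"
  proof (rule l2_fps_divide_poly[of ?r])
    fix a assume a: "poly ?r a = 0"
    then have "a \<noteq> 0" using r0 by (auto simp: poly_0_coeff_0)
    with a have "poly p (inverse a) = 0" by (simp add: poly_reflect_poly_nz)
    with roots have "cmod (inverse a) < 1" by blast
    with \<open>a \<noteq> 0\<close> show "1 < cmod a" by (simp add: norm_inverse inverse_less_1_iff)
  qed (use r0 V F in auto)
  define v where "v = ell2_of V"
  have cv: "coord (poly_mult ?r v) n = cnj (coord z n)" for n
    by (metis F_def V \<open>l2_fps V\<close> fps_nth_Abs_fps nth_series series_ell2_of series_poly_mult v_def)
  have "norm (poly_mult ?r v) = norm z"
    by (simp add: norm_ell2_def cv)
  moreover have "\<alpha> * norm v \<le> norm (poly_mult ?r v)"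
  proof (rule poly_mult_lower_bound[OF _ \<alpha>(2)])
    fix u assume u: "cmod u = 1"
    then have "u \<noteq> 0" by auto
    with u \<alpha>(1)[of "inverse u"] show "\<alpha> \<le> cmod (poly ?r u)"
      by (simp add: poly_reflect_poly_nz norm_mult norm_power norm_inverse)
  qed
  ultimately have v: "\<alpha> * norm v \<le> norm z" by simp
  have "complex_of_real ((norm z)\<^sup>2) = (\<Sum>n. complex_of_real ((cmod (coord z n))\<^sup>2))"
    using suminf_of_real[OF summable_coord[of z]] by (simp add: norm_ell2_def suminf_nonneg summable_coord)
  also have "\<dots> = (\<Sum>n. coord z n * coord (poly_mult ?r v) n)"
    by (simp only: complex_norm_square cv)
  also have "\<dots> = (\<Sum>n. coord ?y n * coord v n)"
    by (rule pairing_reflect_poly)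
  finally have "(norm z)\<^sup>2 \<le> norm ?y * norm v"
    by (metis norm_of_real norm_pairing_le abs_ge_self order_trans)
  then have "\<alpha> * (norm z * norm z) \<le> \<alpha> * (norm ?y * norm v)"
    by (intro mult_left_mono \<alpha>(2)) (simp add: power2_eq_square)
  also have "\<dots> \<le> norm ?y * norm z"
    using mult_left_mono[OF v norm_ge_zero[of ?y]] by (simp add: mult_ac)
  finally have "(\<alpha> * norm z) * norm z \<le> norm ?y * norm z"
    by (simp add: mult_ac)
  then show ?thesis
    using False by (simp add: mult_le_cancel_right)
qed simp

section \<open>The resolvent set is open\<close>

text \<open>
  Completeness is what the fixed point argument behind the openness of the resolvent set rests on.
  The limit is formed coordinatewise, and each bound passes to it on initial segments.
\<close>

instance ell2 :: complete_space
proof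
  fix X :: "nat \<Rightarrow> ell2"
  assume X: "Cauchy X"
  have "Cauchy (\<lambda>j. coord (X j) n)" for n
  proof (rule CauchyI)
    fix e :: real assume "e > 0"
    then obtain N where N: "\<And>i j. i \<ge> N \<Longrightarrow> j \<ge> N \<Longrightarrow> norm (X i - X j) < e"
      using CauchyD[OF X] by blast
    have "cmod (coord (X i) n - coord (X j) n) \<le> norm (X i - X j)" for i j
      using norm_coord_le[of "X i - X j" n] by (simp add: minus_ell2.rep_eq)
    then show "\<exists>N. \<forall>i\<ge>N. \<forall>j\<ge>N. norm (coord (X i) n - coord (X j) n) < e"
      using N by (intro exI[of _ N] allI impI) (rule le_less_trans)
  qed
  then have "convergent (\<lambda>j. coord (X j) n)" for n
    by (rule Cauchy_convergent)
  then obtain L where L: "\<And>n. (\<lambda>j. coord (X j) n) \<longlonglongrightarrow> L n"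
    unfolding convergent_def by metis
  define F where "F = Abs_fps L"
  have near: "l2_fps (series (X i) - F) \<and> norm (ell2_of (series (X i) - F)) \<le> e"
    if "\<And>j. j \<ge> N \<Longrightarrow> norm (X i - X j) < e" for i N e
  proof -
    have "L2_set (\<lambda>n. cmod (fps_nth (series (X i) - F) n)) {..<M} \<le> e" for M
    proof (rule LIMSEQ_le_const2)
      show "(\<lambda>j. L2_set (\<lambda>n. cmod (coord (X i - X j) n)) {..<M})
          \<longlonglongrightarrow> L2_set (\<lambda>n. cmod (fps_nth (series (X i) - F) n)) {..<M}"
        unfolding L2_set_def by (auto simp: minus_ell2.rep_eq F_def intro!: tendsto_intros L)
      show "\<exists>N. \<forall>j\<ge>N. L2_set (\<lambda>n. cmod (coord (X i - X j) n)) {..<M} \<le> e"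
        using that L2_set_coord_le_norm by (metis less_imp_le order_trans)
    qed
    then show ?thesis
      using l2_fps_bounded by blast
  qed
  obtain N where "\<And>i j. i \<ge> N \<Longrightarrow> j \<ge> N \<Longrightarrow> norm (X i - X j) < 1"
    using CauchyD[OF X zero_less_one] by blast
  then have "l2_fps (series (X N) - F)"
    using near[of N N 1] by blast
  then have "l2_fps (series (X N) + fps_const (- 1) * (series (X N) - F))"
    by (intro l2_fps_add l2_fps_cmult l2_series)
  moreover have "series (X N) + fps_const (- 1) * (series (X N) - F) = F"
    by (rule fps_ext) simp
  ultimately have F: "l2_fps F" by simp
  have diff: "ell2_of (series (X i) - F) = X i - ell2_of F" if "l2_fps (series (X i) - F)" for i
    by (subst series_inject[symmetric]) (simp add: that series_ell2_of F series_diff)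
  have "X \<longlonglongrightarrow> ell2_of F"
  proof (rule LIMSEQ_I)
    fix e :: real assume "e > 0"
    then obtain N where N: "\<And>i j. i \<ge> N \<Longrightarrow> j \<ge> N \<Longrightarrow> norm (X i - X j) < e / 2"
      using CauchyD[OF X, of "e / 2"] by auto
    have "norm (X i - ell2_of F) < e" if "i \<ge> N" for i
      using near[of N i "e / 2"] N[OF that] diff[of i] \<open>e > 0\<close> by auto
    then show "\<exists>N. \<forall>i\<ge>N. norm (X i - ell2_of F) < e" by blast
  qed
  then show "convergent X" by (auto simp: convergent_def)
qed

lemma scaleC_add_right: "c *\<^sub>C (x + y) = c *\<^sub>C x + c *\<^sub>C y"
  and scaleC_diff_left: "(c - d) *\<^sub>C x = c *\<^sub>C x - d *\<^sub>C x"
  and scaleC_diff_right: "c *\<^sub>C (x - y) = c *\<^sub>C x - c *\<^sub>C y"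
  and scaleC_scaleC: "c *\<^sub>C d *\<^sub>C x = (c * d) *\<^sub>C x"
  by (transfer; simp add: fun_eq_iff algebra_simps)+

text \<open>
  If \<open>B\<close> inverts \<open>A - w\<close>, then \<open>(A - v) x = y\<close> is the fixed point equation
  \<open>x = B (y + (v - w) x)\<close>, whose right-hand side is a contraction in \<open>x\<close> for \<open>v\<close> near \<open>w\<close>.
\<close>

lemma open_resolvent_set:
  assumes add: "\<And>x y. A (x + y) = A x + A y" and scale: "\<And>c x. A (c *\<^sub>C x) = c *\<^sub>C A x"
  shows "open (resolvent_set A)"
  unfolding open_dist
proof
  fix w assume "w \<in> resolvent_set A"
  then obtain B where B: "bounded_clinear B" "\<And>x. B (A x - w *\<^sub>C x) = x" "\<And>x. A (B x) - w *\<^sub>C B x = x"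
    unfolding resolvent_set_def by blast
  interpret B: bounded_linear B
    using B(1) by (simp add: bounded_clinear_def)
  obtain K where K: "K > 0" "\<And>x. norm (B x) \<le> K * norm x"
    using B.pos_bounded by (auto simp: mult.commute)
  have "v \<in> resolvent_set A" if "dist v w < 1 / (2 * K)" for v
  proof -
    let ?c = "K * cmod (v - w)"
    have c: "?c \<le> 1 / 2" "0 \<le> ?c"
      using that K(1) by (auto simp: dist_norm field_simps)
    have eq_iff: "A x - v *\<^sub>C x = y \<longleftrightarrow> B (y + (v - w) *\<^sub>C x) = x" for x y
    proof -
      have "A x - v *\<^sub>C x = y \<longleftrightarrow> A x - w *\<^sub>C x = y + (v - w) *\<^sub>C x"
        by (auto simp: scaleC_diff_left algebra_simps)
      also have "\<dots> \<longleftrightarrow> B (y + (v - w) *\<^sub>C x) = x"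
        using B(2,3) by metis
      finally show ?thesis .
    qed
    have ex1: "\<exists>!x. A x - v *\<^sub>C x = y" for y
      unfolding eq_iff
    proof (rule banach_fix_type[OF c(2)])
      show "?c < 1" using c by simp
      have "dist (B (y + (v - w) *\<^sub>C x)) (B (y + (v - w) *\<^sub>C x')) \<le> ?c * dist x x'" for x x'
        using K(2)[of "(v - w) *\<^sub>C (x - x')"]
        by (simp add: dist_norm norm_scaleC mult.assoc flip: B.diff scaleC_diff_right)
      then show "\<forall>x x'. dist (B (y + (v - w) *\<^sub>C x)) (B (y + (v - w) *\<^sub>C x')) \<le> ?c * dist x x'" by blast
    qed
    define B' where "B' y = (THE x. A x - v *\<^sub>C x = y)" for y
    have B': "A (B' y) - v *\<^sub>C B' y = y" for y
      using theI'[OF ex1[of y]] by (simp add: B'_def)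
    have uniq: "B' y = x" if "A x - v *\<^sub>C x = y" for x y
      using ex1[of y] B' that by blast
    have B'_add: "B' (y + z) = B' y + B' z" for y z
      by (rule uniq) (use B'[of y] B'[of z] in \<open>simp add: add scaleC_add_right algebra_simps\<close>)
    have B'_scale: "B' (a *\<^sub>C y) = a *\<^sub>C B' y" for a y
    proof (rule uniq)
      have "A (a *\<^sub>C B' y) - v *\<^sub>C a *\<^sub>C B' y = a *\<^sub>C (A (B' y) - v *\<^sub>C B' y)"
        by (simp add: scale scaleC_diff_right scaleC_scaleC mult.commute)
      then show "A (a *\<^sub>C B' y) - v *\<^sub>C a *\<^sub>C B' y = a *\<^sub>C y"
        by (simp add: B')
    qed
    have "norm (B' y) \<le> norm y * (2 * K)" for y
    proof -
      have "norm (B' y) \<le> K * norm (y + (v - w) *\<^sub>C B' y)"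
        using K(2) eq_iff[of "B' y" y] B' by metis
      also have "\<dots> \<le> K * (norm y + cmod (v - w) * norm (B' y))"
        using K(1) norm_triangle_ineq[of y "(v - w) *\<^sub>C B' y"] by (simp add: norm_scaleC)
      also have "\<dots> = K * norm y + ?c * norm (B' y)"
        by (simp add: algebra_simps)
      also have "\<dots> \<le> K * norm y + 1 / 2 * norm (B' y)"
        by (intro add_left_mono mult_right_mono c) simp
      finally show ?thesis by (simp add: mult_ac)
    qed
    then have "bounded_linear B'"
      by (intro bounded_linear_intro[of _ "2 * K"]) (auto simp: B'_add B'_scale scaleR_ell2_def)
    then have "bounded_clinear B'"
      by (simp add: bounded_clinear_def B'_scale)
    then show ?thesis
      unfolding resolvent_set_def using B' uniq by blast
  qed
  then show "\<exists>e>0. \<forall>v. dist v w < e \<longrightarrow> v \<in> resolvent_set A"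
    using K(1) by (intro exI[of _ "1 / (2 * K)"]) auto
qed

section \<open>Roots of the symbol at points of the resolvent set\<close>

text \<open>
  A factor \<open>z - q\<close> with \<open>\<bar>q\<bar> = 1\<close> destroys surjectivity. After removing the phase \<open>q\<^sup>j\<close>, the
  coefficients of a preimage \<open>Z\<close> have prescribed differences; if these are a multiple of the harmonic
  series, which are square summable but not summable, then the coefficients are unbounded.
\<close>

lemma surj_imp_no_unit_root:
  assumes surj: "\<And>y. \<exists>x. left_shift m (poly_mult p x) = y" and q: "poly p q = 0"
  shows "cmod q \<noteq> 1"
proof
  assume q1: "cmod q = 1"
  then have q0: "q \<noteq> 0" by auto
  obtain r where r: "p = [:- q, 1:] * r"
    using q by (auto simp: poly_eq_0_iff_dvd elim: dvdE)
  define Y where "Y = Abs_fps (\<lambda>n. inverse (q ^ n) / of_nat n)"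
  have "l2_fps Y"
    using inverse_power_summable[of 2, where 'a = real]
    by (simp add: l2_fps_def Y_def norm_divide norm_inverse norm_power q1 power_divide divide_inverse power_inverse norm_mult power_mult_distrib)
  obtain x where x: "left_shift m (poly_mult p x) = ell2_of Y"
    using surj by blast
  define Z where "Z = fps_of_poly r * series x"
  have "l2_fps Z" by (simp add: Z_def l2_fps_poly_mult)
  define c where "c j = q ^ j * fps_nth Z (m + j)" for j
  have "fps_nth (fps_of_poly [:- q, 1:] * Z) (n + m) = fps_nth Y n" for n
    using arg_cong[OF x, of series] series_ell2_of[OF \<open>l2_fps Y\<close>]
    by (simp add: r Z_def fps_of_poly_mult mult.assoc del: mult_pCons_left flip: fps_shift_nth)
  from this[of "Suc _"] have step: "fps_nth Z (m + j) - q * fps_nth Z (m + Suc j) = inverse (q ^ Suc j) / of_nat (Suc j)" for j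
    unfolding nth_linear_mult by (simp add: Y_def add.commute)
  have "c j - c (Suc j) = inverse q / of_nat (Suc j)" for j
  proof -
    have "c j - c (Suc j) = q ^ j * (fps_nth Z (m + j) - q * fps_nth Z (m + Suc j))"
      by (simp add: c_def algebra_simps)
    then show ?thesis using q0 unfolding step by simp
  qed
  then have "(\<Sum>j<J. inverse q / of_nat (Suc j)) = c 0 - c J" for J
    using sum_lessThan_telescope'[of c J] by simp
  then have eq: "inverse q * complex_of_real (\<Sum>j<J. 1 / real (Suc j)) = c 0 - c J" for J
    by (simp add: sum_distrib_left divide_inverse)
  have bound: "cmod (c j) \<le> norm (ell2_of Z)" for j
    using norm_coord_le[of "ell2_of Z" "m + j"]
    by (simp add: c_def norm_mult norm_power q1 coord_ell2_of[OF \<open>l2_fps Z\<close>])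
  have "(\<Sum>j<J. 1 / real (Suc j)) \<le> 2 * norm (ell2_of Z)" for J
  proof -
    have "(\<Sum>j<J. 1 / real (Suc j)) = cmod (inverse q * complex_of_real (\<Sum>j<J. 1 / real (Suc j)))"
      unfolding norm_mult norm_of_real by (simp add: norm_inverse q1 sum_nonneg)
    also have "\<dots> \<le> cmod (c 0) + cmod (c J)"
      unfolding eq by (rule norm_triangle_ineq4)
    finally show ?thesis using bound[of 0] bound[of J] by simp
  qed
  then have "summable (\<lambda>j. 1 / real (Suc j))"
    by (intro summableI_nonneg_bounded) auto
  then show False
    using not_summable_harmonic[where 'a = real] summable_Suc_iff[of "\<lambda>j. 1 / real j"]
    by (simp add: inverse_eq_divide)
qed

text \<open>
  The preimage of the first basis vector turns \<open>q\<close> times a square summable series into a polynomial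
  of degree exactly \<open>m\<close>, which leaves room for at most \<open>m\<close> roots of the closed disc.
\<close>

lemma surj_imp_degree_le:
  assumes surj: "\<And>y. \<exists>x. left_shift m (poly_mult (q * r) x) = y"
    and q: "q \<noteq> 0" "\<And>z. poly q z = 0 \<Longrightarrow> cmod z \<le> 1"
  shows "degree q \<le> m"
proof (rule ccontr)
  assume deg: "\<not> degree q \<le> m"
  have one: "l2_fps (1 :: complex fps)"
    using l2_fps_of_poly[of 1] by simp
  obtain x where "left_shift m (poly_mult (q * r) x) = ell2_of 1"
    using surj by blast
  then have x: "fps_nth (fps_of_poly (q * r) * series x) (n + m) = (if n = 0 then 1 else 0)" for n
    using one by (metis coord_ell2_of coord_left_shift fps_one_nth nth_series series_poly_mult)
  let ?V = "fps_of_poly r * series x"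
  have "fps_nth (fps_of_poly q * ?V) n = 0" if "n \<ge> Suc m" for n
    using x[of "n - m"] that by (simp add: fps_of_poly_mult mult.assoc)
  then have "fps_nth ?V n = 0" for n
    using poly_divide_vanishing[OF q, of ?V "Suc m" n] deg by (simp add: l2_fps_poly_mult)
  then have "?V = 0" by (intro fps_ext) simp
  with x[of 0] show False by (simp add: fps_of_poly_mult mult.assoc)
qed

text \<open>
  If \<open>q\<close> had degree less than \<open>m\<close>, the square summable series \<open>1/r\<close> would be mapped by
  \<open>q r\<close> to \<open>q\<close>, which the shift annihilates.
\<close>

lemma inj_imp_degree_ge:
  assumes inj: "\<And>x. left_shift m (poly_mult (q * r) x) = 0 \<Longrightarrow> x = 0"
    and r: "r \<noteq> 0" "\<And>z. poly r z = 0 \<Longrightarrow> 1 < cmod z"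
  shows "m \<le> degree q"
proof (rule ccontr)
  assume deg: "\<not> m \<le> degree q"
  have "poly r 0 \<noteq> 0"
    using r(2)[of 0] by auto
  then have r0: "coeff r 0 \<noteq> 0"
    by (simp only: poly_0_coeff_0 not_False_eq_True)
  define V where "V = inverse (fps_of_poly r)"
  have V: "fps_of_poly r * V = 1"
    using r0 inverse_mult_eq_1'[of "fps_of_poly r"] by (simp add: V_def)
  have "l2_fps (fps_of_poly r * V)"
    using l2_fps_of_poly[of 1] by (simp add: V)
  then have l2: "l2_fps V"
    using l2_fps_divide_poly r by blast
  have "series (poly_mult (q * r) (ell2_of V)) = fps_of_poly q"
    by (simp add: series_ell2_of[OF l2] fps_of_poly_mult mult.assoc V)
  then have "coord (poly_mult (q * r) (ell2_of V)) n = coeff q n" for n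
    by (metis fps_of_poly_nth nth_series)
  then have "left_shift m (poly_mult (q * r) (ell2_of V)) = 0"
    using deg by (intro ell2_eqI) (simp add: coeff_eq_0 zero_ell2.rep_eq)
  then have "ell2_of V = 0" by (rule inj)
  then have "V = 0" using series_ell2_of[OF l2] by (simp add: series_zero)
  with V show False by simp
qed

text \<open>
  Cauchy's bound: for \<open>\<bar>a\<bar> > 1\<close> all lower terms are at most \<open>S \<bar>a\<bar>\<^sup>n\<^sup>-\<^sup>1\<close> together,
  where \<open>n\<close> is the degree.
\<close>

lemma root_bound:
  fixes p :: "complex poly"
  assumes "poly p a = 0" "degree p > 0" "(\<Sum>i<degree p. cmod (coeff p i)) \<le> S"
  shows "cmod a \<le> 1 + S / cmod (lead_coeff p)"
proof (cases "cmod a \<le> 1")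
  case True
  moreover have "S \<ge> 0"
    by (rule order_trans[OF _ assms(3)]) (simp add: sum_nonneg)
  ultimately show ?thesis by (simp add: add_increasing2)
next
  case False
  obtain n where n: "degree p = Suc n" using assms(2) gr0_implies_Suc by blast
  have "lead_coeff p * a ^ Suc n = - (\<Sum>i<Suc n. coeff p i * a ^ i)"
    using assms(1) unfolding poly_altdef n lessThan_Suc_atMost[symmetric] sum.lessThan_Suc[of _ "Suc n"]
    by (simp add: add_eq_0_iff n)
  then have "cmod (lead_coeff p) * cmod a ^ Suc n = cmod (\<Sum>i<Suc n. coeff p i * a ^ i)"
    by (metis norm_minus_cancel norm_mult norm_power)
  also have "\<dots> \<le> (\<Sum>i<Suc n. cmod (coeff p i) * cmod a ^ n)"
    using False
    by (intro sum_norm_le) (auto simp: norm_mult norm_power intro!: mult_left_mono power_increasing)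
  also have "\<dots> \<le> S * cmod a ^ n"
    using assms(3) by (simp add: n mult_right_mono flip: sum_distrib_right)
  finally have "(cmod (lead_coeff p) * cmod a) * cmod a ^ n \<le> S * cmod a ^ n"
    by (simp add: mult_ac)
  then have "cmod (lead_coeff p) * cmod a \<le> S"
    by (rule mult_right_le_imp_le) (use False in \<open>intro zero_less_power, linarith\<close>)
  moreover have "cmod (lead_coeff p) > 0" using assms(2) by auto
  ultimately have "cmod a \<le> S / cmod (lead_coeff p)"
    by (simp add: pos_le_divide_eq mult.commute)
  then show ?thesis by simp
qed

section \<open>Resolvents of Toeplitz operators with Laurent polynomial symbol\<close>

text \<open>
  The symbol \<open>b - w\<close> cleared of its denominator \<open>z\<^sup>m\<close>.
\<close>

definition symbol_poly :: "nat \<Rightarrow> nat \<Rightarrow> (int \<Rightarrow> complex) \<Rightarrow> complex \<Rightarrow> complex poly"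
  where "symbol_poly m k b w = (\<Sum>j\<le>m + k. monom (b (int j - int m)) j) - monom w m"

lemma coeff_symbol_poly:
  "coeff (symbol_poly m k b w) j = (if j \<le> m + k then b (int j - int m) else 0) - (if j = m then w else 0)"
  by (simp add: symbol_poly_def coeff_sum coeff_monom sum.delta eq_commute[of _ m] cong: if_cong)

lemma poly_symbol_poly:
  assumes "z \<noteq> 0"
  shows "poly (symbol_poly m k b w) z = z ^ m * (laurent_poly m k b z - w)"
proof -
  have "z ^ m * laurent_poly m k b z = (\<Sum>d = - int m..int k. b d * z ^ nat (d + int m))"
    unfolding laurent_poly_def sum_distrib_left
  proof (rule sum.cong)
    fix d assume "d \<in> {- int m..int k}"
    then have "z ^ nat (d + int m) = z powi (d + int m)"
      by (simp add: power_int_def)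
    also have "\<dots> = z powi d * z ^ m"
      using assms by (simp add: power_int_add)
    finally show "z ^ m * (b d * z powi d) = b d * z ^ nat (d + int m)" by simp
  qed simp
  also have "\<dots> = (\<Sum>j\<le>m + k. b (int j - int m) * z ^ j)"
    by (rule sum.reindex_bij_witness[of _ "\<lambda>j. int j - int m" "\<lambda>d. nat (d + int m)"]) auto
  finally show ?thesis
    by (simp add: symbol_poly_def poly_sum poly_monom algebra_simps)
qed

lemma degree_symbol_poly:
  assumes "k \<ge> 1" "b (int k) \<noteq> 0"
  shows "degree (symbol_poly m k b w) = m + k" and "lead_coeff (symbol_poly m k b w) = b (int k)"
proof -
  show "degree (symbol_poly m k b w) = m + k"
    by (rule antisym[OF degree_le le_degree]) (use assms in \<open>auto simp: coeff_symbol_poly\<close>)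
  then show "lead_coeff (symbol_poly m k b w) = b (int k)"
    using assms by (simp add: coeff_symbol_poly)
qed

lemma toeplitz_minus_eq:
  "toeplitz (laurent_poly m k b) x - w *\<^sub>C x = left_shift m (poly_mult (symbol_poly m k b w) x)"
proof (rule ell2_eqI)
  fix i
  let ?p = "symbol_poly m k b w"
  let ?x = "\<lambda>j. if j \<le> i + m then coord x (i + m - j) else 0"
  have "degree ?p \<le> m + k"
    by (rule degree_le) (auto simp: coeff_symbol_poly)
  have "coord (left_shift m (poly_mult ?p x)) i = fps_nth (fps_of_poly ?p * series x) (i + m)"
    by (metis coord_left_shift nth_series series_poly_mult)
  also have "\<dots> = (\<Sum>j\<le>m + k. coeff ?p j * ?x j)"
    by (simp add: nth_poly_mult[OF \<open>degree ?p \<le> m + k\<close>] cong: if_cong)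
  also have "\<dots> = (\<Sum>j\<le>m + k. b (int j - int m) * ?x j - (if j = m then w * ?x j else 0))"
    by (intro sum.cong refl) (auto simp: coeff_symbol_poly algebra_simps)
  also have "\<dots> = (\<Sum>j\<le>m + k. b (int j - int m) * ?x j) - w * coord x i"
    by (simp add: sum_subtractf)
  also have "(\<Sum>j\<le>m + k. b (int j - int m) * ?x j)
      = (\<Sum>d = - int m..int k. b d * (if d \<le> int i then coord x (nat (int i - d)) else 0))"
    by (rule sum.reindex_bij_witness[of _ "\<lambda>d. nat (d + int m)" "\<lambda>j. int j - int m"])
      (auto simp: nat_diff_distrib' nat_add_distrib nat_le_iff intro!: arg_cong[of _ _ "coord x"])
  finally show "coord (toeplitz (laurent_poly m k b) x - w *\<^sub>C x) i = coord (left_shift m (poly_mult ?p x)) i"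
    by (simp add: minus_ell2.rep_eq scaleC.rep_eq coord_toeplitz_laurent_poly)
qed

lemma toeplitz_eq: "toeplitz (laurent_poly m k b) x = left_shift m (poly_mult (symbol_poly m k b 0) x)"
proof -
  have "0 *\<^sub>C x = 0"
    by (subst series_inject[symmetric]) (simp add: series_scaleC series_zero)
  then show ?thesis
    using toeplitz_minus_eq[of m k b x 0] by simp
qed

lemma resolvent_set_bijective:
  assumes "w \<in> resolvent_set A"
  shows "\<exists>x. A x - w *\<^sub>C x = y" and "A x - w *\<^sub>C x = A x' - w *\<^sub>C x' \<Longrightarrow> x = x'"
proof -
  obtain B where B: "\<And>x. B (A x - w *\<^sub>C x) = x" "\<And>x. A (B x) - w *\<^sub>C B x = x"
    using assms unfolding resolvent_set_def by blast
  show "\<exists>x. A x - w *\<^sub>C x = y"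
    using B(2) by blast
  show "x = x'" if "A x - w *\<^sub>C x = A x' - w *\<^sub>C x'"
    using arg_cong[OF that, of B] by (simp only: B(1))
qed

text \<open>
  At \<open>w = b(z)\<close> the polynomial of the symbol vanishes at a point of the circle. Hence the distance
  to the spectrum is a lower bound for \<open>\<bar>b - w\<bar>\<close> on the circle, and the spectrum is not empty.
\<close>

lemma laurent_poly_in_spectrum:
  assumes "cmod z = 1"
  shows "laurent_poly m k b z \<in> spectrum (toeplitz (laurent_poly m k b))"
proof (rule ccontr)
  let ?w = "laurent_poly m k b z"
  assume "?w \<notin> spectrum (toeplitz (laurent_poly m k b))"
  then have "?w \<in> resolvent_set (toeplitz (laurent_poly m k b))"
    by (simp add: spectrum_def)
  from resolvent_set_bijective(1)[OF this]
  have "\<exists>x. left_shift m (poly_mult (symbol_poly m k b ?w) x) = y" for y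
    by (simp add: toeplitz_minus_eq)
  moreover have "poly (symbol_poly m k b ?w) z = 0"
    using assms by (subst poly_symbol_poly) auto
  ultimately show False
    using surj_imp_no_unit_root assms by blast
qed

lemma infdist_spectrum_le:
  assumes "cmod z = 1"
  shows "infdist w (spectrum (toeplitz (laurent_poly m k b))) \<le> cmod (laurent_poly m k b z - w)"
  using infdist_le[OF laurent_poly_in_spectrum[OF assms]] by (simp add: dist_norm norm_minus_commute)

text \<open>
  The right-hand side of the main estimate would be zero at distance zero, because of \<open>1 / 0 = 0\<close>.
  This case is excluded since the spectrum is closed.
\<close>

lemma infdist_spectrum_pos:
  assumes "w \<in> resolvent_set (toeplitz (laurent_poly m k b))"
  shows "infdist w (spectrum (toeplitz (laurent_poly m k b))) > 0"
proof -
  let ?T = "toeplitz (laurent_poly m k b)"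
  have "?T (x + y) = ?T x + ?T y" "?T (c *\<^sub>C x) = c *\<^sub>C ?T x" for x y c
    by (simp_all add: toeplitz_eq poly_mult_add poly_mult_scaleC left_shift_add left_shift_scaleC)
  then have "closed (spectrum ?T)"
    unfolding spectrum_def closed_def by (simp add: open_resolvent_set)
  moreover have "spectrum ?T \<noteq> {}" "w \<notin> spectrum ?T"
    using laurent_poly_in_spectrum[of 1] assms by (auto simp: spectrum_def)
  ultimately show ?thesis
    using in_closed_iff_infdist_zero infdist_nonneg by (metis less_eq_real_def)
qed

text \<open>
  On the circle \<open>d \<le> \<bar>b - w\<bar> = \<bar>q\<bar> \<bar>r\<bar>\<close>, where \<open>q\<close> and \<open>r\<close> carry the roots inside and outside the
  disc. Each factor is bounded above uniformly for \<open>\<bar>w\<bar> \<le> R\<close>, since its degree does not depend on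
  \<open>w\<close> and its roots stay bounded. So each factor is also at least a constant times \<open>d\<close>, and composing
  the two lower bounds costs \<open>d\<^sup>2\<close>. The estimate is on the maximum of the whole factors: multiplying
  the bounds for single roots would give a power of \<open>d\<close> that grows with the degree.
\<close>

lemma resolvent_bound_on_bounded_set:
  assumes "k \<ge> 1" "b (int k) \<noteq> 0"
  shows "\<exists>C>0. \<forall>w\<in>resolvent_set (toeplitz (laurent_poly m k b)). cmod w \<le> R \<longrightarrow>
    (\<forall>x. (infdist w (spectrum (toeplitz (laurent_poly m k b))))\<^sup>2 * norm x
      \<le> C * norm (toeplitz (laurent_poly m k b) x - w *\<^sub>C x))"
proof -
  let ?T = "toeplitz (laurent_poly m k b)"
  define S where "S = (\<Sum>j<m + k. cmod (b (int j - int m))) + \<bar>R\<bar>"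
  define U where "U = cmod (b (int k)) * (1 + (1 + S / cmod (b (int k)))) ^ k"
  have "S \<ge> 0" by (simp add: S_def sum_nonneg)
  then have U: "U > 0"
    using assms(2) by (auto simp: U_def intro!: mult_pos_pos zero_less_power add_pos_nonneg)
  have "(infdist w (spectrum ?T))\<^sup>2 * norm x \<le> (2 ^ m * U) * norm (?T x - w *\<^sub>C x)"
    if w: "w \<in> resolvent_set ?T" "cmod w \<le> R" for w x
  proof -
    let ?d = "infdist w (spectrum ?T)" and ?p = "symbol_poly m k b w"
    have d: "?d > 0" by (rule infdist_spectrum_pos[OF w(1)])
    have surj: "\<exists>x. left_shift m (poly_mult ?p x) = y" for y
      using resolvent_set_bijective(1)[OF w(1)] by (simp add: toeplitz_minus_eq)
    have inj: "x = 0" if "left_shift m (poly_mult ?p x) = 0" for x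
    proof (rule resolvent_set_bijective(2)[OF w(1)])
      show "?T x - w *\<^sub>C x = ?T 0 - w *\<^sub>C 0"
        unfolding toeplitz_minus_eq that
        by (subst series_inject[symmetric]) (simp add: series_zero)
    qed
    have deg: "degree ?p = m + k" "lead_coeff ?p = b (int k)"
      using degree_symbol_poly assms by blast+
    then have "?p \<noteq> 0" using assms(2) by auto
    then obtain q r where qr: "?p = q * r" "lead_coeff q = 1" "r \<noteq> 0"
      "\<And>z. poly q z = 0 \<Longrightarrow> cmod z \<le> 1" "\<And>z. poly r z = 0 \<Longrightarrow> 1 < cmod z"
      using poly_split_unit_disc by blast
    have "q \<noteq> 0" using qr(2) by auto
    \<comment> \<open>Surjectivity bounds the number of roots inside from above and injectivity from below.\<close>
    have degq: "degree q = m"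
      using surj_imp_degree_le[of m q r] inj_imp_degree_ge[of m q r] surj inj qr \<open>q \<noteq> 0\<close>
      by (intro antisym) (metis (full_types))+
    then have degr: "degree r = k"
      using deg(1) qr(1,3) \<open>q \<noteq> 0\<close> by (simp add: degree_mult_eq)
    have lcr: "lead_coeff r = b (int k)"
      using deg(2) qr(1,2) by (simp add: lead_coeff_mult)
    have roots_q: "cmod z < 1" if "poly q z = 0" for z
      using surj_imp_no_unit_root[OF surj, of z] qr(4)[OF that] that qr(1) by fastforce
    have pd: "?d \<le> cmod (poly q z) * cmod (poly r z)" if "cmod z = 1" for z
    proof -
      have "z \<noteq> 0" using that by auto
      then have "cmod (poly ?p z) = cmod (laurent_poly m k b z - w)"
        by (simp add: poly_symbol_poly norm_mult norm_power that)
      then show ?thesis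
        using infdist_spectrum_le[OF that, of w m k b] by (simp add: qr(1) norm_mult)
    qed
    have q_le: "cmod (poly q z) \<le> 2 ^ m" if "cmod z = 1" for z
      using norm_poly_le_of_roots[OF \<open>q \<noteq> 0\<close>, of 1 z] qr(2,4) that degq by simp
    have r_le: "cmod (poly r z) \<le> U" if "cmod z = 1" for z
    proof -
      have roots_r: "cmod a \<le> 1 + S / cmod (b (int k))" if "poly r a = 0" for a
      proof -
        have "(\<Sum>j<m + k. cmod (coeff ?p j))
            \<le> (\<Sum>j<m + k. cmod (b (int j - int m)) + (if j = m then cmod w else 0))"
          by (intro sum_mono) (auto simp: coeff_symbol_poly intro: norm_triangle_ineq4)
        also have "\<dots> \<le> S"
          using w(2) assms(1) by (simp add: sum.distrib S_def)
        finally show ?thesis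
          using root_bound[of ?p a S] that assms(1) deg qr(1) by simp
      qed
      then show ?thesis
        using norm_poly_le_of_roots[OF qr(3) roots_r, of z] that lcr
        by (simp add: U_def degr)
    qed
    have "?d / U \<le> cmod (poly q z)" "?d / 2 ^ m \<le> cmod (poly r z)" if "cmod z = 1" for z
    proof -
      have "?d \<le> cmod (poly q z) * U"
        using pd[OF that] mult_left_mono[OF r_le[OF that], of "cmod (poly q z)"] by simp
      then show "?d / U \<le> cmod (poly q z)" using U by (simp add: pos_divide_le_eq)
      have "?d \<le> 2 ^ m * cmod (poly r z)"
        using pd[OF that] mult_right_mono[OF q_le[OF that], of "cmod (poly r z)"] by simp
      then show "?d / 2 ^ m \<le> cmod (poly r z)" by (simp add: pos_divide_le_eq mult.commute)
    qed
    note lower = this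
    \<comment> \<open>The analytic factor \<open>r\<close> and the coanalytic factor \<open>z\<^sup>-\<^sup>m q\<close> are bounded below separately.\<close>
    have 1: "?d / 2 ^ m * norm x \<le> norm (poly_mult r x)"
      by (rule poly_mult_lower_bound) (use lower d in auto)
    have 2: "?d / U * norm (poly_mult r x) \<le> norm (left_shift m (poly_mult q (poly_mult r x)))"
      unfolding degq[symmetric]
      using lower d U
      by (intro left_shift_poly_mult_lower_bound[OF \<open>q \<noteq> 0\<close> roots_q]) (auto simp: degq)
    have "?d / U * (?d / 2 ^ m * norm x) \<le> ?d / U * norm (poly_mult r x)"
      using 1 d U by (intro mult_left_mono) auto
    also note 2
    finally have "?d / U * (?d / 2 ^ m * norm x) \<le> norm (?T x - w *\<^sub>C x)"
      by (simp only: toeplitz_minus_eq qr(1) poly_mult_mult)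
    then show ?thesis
      using U by (simp add: field_simps power2_eq_square)
  qed
  then show ?thesis
    using U by (intro exI[of _ "2 ^ m * U"]) auto
qed

text \<open>
  Far from the origin \<open>w x\<close> dominates \<open>T x\<close>, and the distance to the spectrum is at most \<open>2 \<bar>w\<bar>\<close>
  because the spectrum contains \<open>b(1)\<close>.
\<close>

lemma resolvent_bound_far_away:
  "\<exists>R. \<forall>w x. cmod w > R \<longrightarrow>
    infdist w (spectrum (toeplitz (laurent_poly m k b))) * norm x
      \<le> 4 * norm (toeplitz (laurent_poly m k b) x - w *\<^sub>C x)"
proof -
  let ?T = "toeplitz (laurent_poly m k b)"
  obtain K where K: "K \<ge> 0" "\<And>x. norm (poly_mult (symbol_poly m k b 0) x) \<le> K * norm x"
    using poly_mult_bounded by blast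
  have T: "norm (?T x) \<le> K * norm x" for x
    unfolding toeplitz_eq by (rule order_trans[OF norm_left_shift_le K(2)])
  define R where "R = 2 * (K + cmod (laurent_poly m k b 1))"
  have "infdist w (spectrum ?T) * norm x \<le> 4 * norm (?T x - w *\<^sub>C x)" if "cmod w > R" for w x
  proof -
    have "2 * K + 2 * cmod (laurent_poly m k b 1) < cmod w"
      using that by (simp add: R_def)
    with K(1) norm_ge_zero[of "laurent_poly m k b 1"]
    have K_le: "K \<le> cmod w / 2" and "cmod (laurent_poly m k b 1) \<le> cmod w / 2"
      by (simp_all only: le_divide_eq_numeral1)
    have "infdist w (spectrum ?T) \<le> cmod (laurent_poly m k b 1 - w)"
      by (rule infdist_spectrum_le) simp
    also have "\<dots> \<le> 2 * cmod w"
      using norm_triangle_ineq4[of "laurent_poly m k b 1" w] norm_ge_zero[of w]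
        \<open>cmod (laurent_poly m k b 1) \<le> cmod w / 2\<close> by linarith
    finally have "infdist w (spectrum ?T) * norm x \<le> 2 * cmod w * norm x"
      by (rule mult_right_mono) simp
    moreover have "cmod w * norm x \<le> norm (?T x) + norm (?T x - w *\<^sub>C x)"
      using norm_triangle_ineq4[of "?T x" "?T x - w *\<^sub>C x"] by (simp add: norm_scaleC)
    moreover have "norm (?T x) \<le> cmod w * norm x / 2"
      using T[of x] mult_right_mono[OF K_le, of "norm x"] by simp
    ultimately show ?thesis by simp
  qed
  then show ?thesis by blast
qed

theorem mainTheorem3:
  fixes m k :: nat and b :: "int \<Rightarrow> complex"
  assumes "m \<ge> 1" and "k \<ge> 1" and "b (- int m) * b (int k) \<noteq> 0"
  shows "let T = toeplitz (laurent_poly m k b) in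
    \<exists>C>0. \<forall>w\<in>resolvent_set T.
      onorm (resolvent T w) \<le> C / infdist w (spectrum T) * (1 + 1 / infdist w (spectrum T))"
proof -
  define T where "T = toeplitz (laurent_poly m k b)"
  obtain R where far: "\<And>w x. cmod w > R \<Longrightarrow> infdist w (spectrum T) * norm x \<le> 4 * norm (T x - w *\<^sub>C x)"
    using resolvent_bound_far_away unfolding T_def by blast
  obtain C where C: "C > 0" and near: "\<And>w x. w \<in> resolvent_set T \<Longrightarrow> cmod w \<le> R \<Longrightarrow>
      (infdist w (spectrum T))\<^sup>2 * norm x \<le> C * norm (T x - w *\<^sub>C x)"
    using resolvent_bound_on_bounded_set[where m = m and k = k and b = b and R = R] assms unfolding T_def by fastforce
  have "onorm (resolvent T w) \<le> (C + 4) / infdist w (spectrum T) * (1 + 1 / infdist w (spectrum T))"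
    if w: "w \<in> resolvent_set T" for w
  proof -
    let ?d = "infdist w (spectrum T)"
    have d: "?d > 0" using infdist_spectrum_pos w unfolding T_def by blast
    have expand: "(C + 4) / ?d * (1 + 1 / ?d) = 4 / ?d + C / ?d\<^sup>2 + (C / ?d + 4 / ?d\<^sup>2)"
      using d by (simp add: field_simps power2_eq_square)
    have bound: "norm x \<le> (C + 4) / ?d * (1 + 1 / ?d) * norm (T x - w *\<^sub>C x)" for x
    proof -
      have "norm x \<le> 4 / ?d * norm (T x - w *\<^sub>C x) \<or> norm x \<le> C / ?d\<^sup>2 * norm (T x - w *\<^sub>C x)"
        using far[of w x] near[OF w, of x] d by (cases "cmod w \<le> R") (simp_all add: field_simps)
      moreover have "4 / ?d \<le> (C + 4) / ?d * (1 + 1 / ?d)" "C / ?d\<^sup>2 \<le> (C + 4) / ?d * (1 + 1 / ?d)"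
        unfolding expand using d C by simp_all
      ultimately show ?thesis
        by (elim disjE) (erule order_trans, rule mult_right_mono, assumption, rule norm_ge_zero)+
    qed
    have "T (resolvent T w y) - w *\<^sub>C resolvent T w y = y" for y
      unfolding resolvent_def
      using resolvent_set_bijective(1)[OF w, of y] by (intro f_inv_into_f) auto
    then have "norm (resolvent T w y) \<le> (C + 4) / ?d * (1 + 1 / ?d) * norm y" for y
      using bound[of "resolvent T w y"] by simp
    then show ?thesis
      by (rule onorm_bound[rotated]) (use d C in simp)
  qed
  then show ?thesis
    unfolding Let_def T_def[symmetric] using C by (intro exI[of _ "C + 4"]) auto
qed

end
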